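(* Let $G_1$ and $G_2$ be Lie groups with Lie algebras $\mathfrak{g}_1$ and $\mathfrak{g}_2$, each of them equipped with a left-invariant metric, determined by inner products $\langle\cdot,\cdot\rangle_1$ on $\mathfrak{g}_1$ and $\langle\cdot,\cdot\rangle_2$ on $\mathfrak{g}_2$, and let $\pi\colon G_1\to\operatorname{Aut}(G_2)$ be a (smooth) homomorphism. The product inner product $\langle\cdot,\cdot\rangle=\langle\cdot,\cdot\rangle_1+\langle\cdot,\cdot\rangle_2$ defines a cyclic left-invariant metric on the semidirect product $G_1\ltimes_\pi G_2$ if and only if the left-invariant metrics on $G_1$ and $G_2$ are cyclic and, for each $X_1\in\mathfrak{g}_1$, the derivation $\pi_*(X_1)$ on $\mathfrak{g}_2$ is selfadjoint with respect to $\langle\cdot,\cdot\rangle_2$.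
   Context: A left-invariant metric on a Lie group with Lie algebra $\mathfrak{g}$ and corresponding inner product $\langle\cdot,\cdot\rangle$ on $\mathfrak{g}$ is called cyclic if $\langle [X,Y],Z\rangle+\langle [Y,Z],X\rangle+\langle [Z,X],Y\rangle=0$ for all $X,Y,Z\in\mathfrak{g}$. The Lie algebra of $G_1\ltimes_\pi G_2$ is the semidirect sum $\mathfrak{g}_1+_{\pi_*}\mathfrak{g}_2$, i.e. the vector space $\mathfrak{g}_1\times\mathfrak{g}_2$ with bracket $$[(X_1,X_2),(Y_1,Y_2)]=\bigl([X_1,Y_1],\,[X_2,Y_2]+\pi_*(X_1)(Y_2)-\pi_*(Y_1)(X_2)\bigr),$$ where $\pi_*\colon\mathfrak{g}_1\to\operatorname{Der}(\mathfrak{g}_2)$ is the Lie algebra homomorphism given by the differential of $\pi$. The inner product $\langle\cdot,\cdot\rangle_1+\langle\cdot,\cdot\rangle_2$ on it is $\langle (X_1,X_2),(Y_1,Y_2)\rangle=\langle X_1,Y_1\rangle_1+\langle X_2,Y_2\rangle_2$. *)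

theory Defs
  imports "HOL-Analysis.Analysis" "HOL-Algebra.Bij"
begin

section \<open>Smooth maps between open sets of finite-dimensional spaces\<close>

text \<open>Both notions below are meant for open \<open>S\<close>.\<close>

fun Ck_on :: "nat \<Rightarrow> 'e::real_normed_vector set \<Rightarrow> ('e \<Rightarrow> 'f::real_normed_vector) \<Rightarrow> bool" where
  "Ck_on 0 S f \<longleftrightarrow> continuous_on S f"
| "Ck_on (Suc k) S f \<longleftrightarrow> (\<forall>x\<in>S. f differentiable (at x)) \<and>
     (\<forall>v. Ck_on k S (\<lambda>x. frechet_derivative f (at x) v))"

definition smooth_on :: "'e::real_normed_vector set \<Rightarrow> ('e \<Rightarrow> 'f::real_normed_vector) \<Rightarrow> bool" where
  "smooth_on S f \<longleftrightarrow> (\<forall>k. Ck_on k S f)"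


section \<open>Smooth manifolds\<close>

text \<open>
  A chart is a pair of its domain and its coordinate map (whose values outside the domain are
  irrelevant), and a manifold is represented by an atlas, which need not be maximal. The set of
  points and the topology are recovered from the atlas.

  The model space is an arbitrary finite-dimensional space of class \<^class>\<open>real_inner\<close> rather
  than of class \<^class>\<open>euclidean_space\<close>, because the latter excludes dimension zero. Its inner
  product serves only to fix the topology and is unrelated to any metric on the manifold.
\<close>

type_synonym ('a, 'e) chart = "'a set \<times> ('a \<Rightarrow> 'e)"

definition points :: "('a, 'e) chart set \<Rightarrow> 'a set" where
  "points A = \<Union> (fst ` A)"

definition atlas_topology :: "('a, 'e::topological_space) chart set \<Rightarrow> 'a topology" where
  "atlas_topology A = topology (\<lambda>S. S \<subseteq> points A \<and> (\<forall>(U, \<phi>)\<in>A. open (\<phi> ` (U \<inter> S))))"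

definition smooth_manifold :: "('a, 'e::real_inner) chart set \<Rightarrow> bool" where
  "smooth_manifold A \<longleftrightarrow>
     (\<exists>B::'e set. finite B \<and> span B = UNIV) \<and>
     (\<forall>(U, \<phi>)\<in>A. inj_on \<phi> U \<and> open (\<phi> ` U)) \<and>
     (\<forall>(U, \<phi>)\<in>A. \<forall>(V, \<psi>)\<in>A.
        open (\<phi> ` (U \<inter> V)) \<and> smooth_on (\<phi> ` (U \<inter> V)) (\<psi> \<circ> inv_into U \<phi>)) \<and>
     Hausdorff_space (atlas_topology A) \<and> second_countable (atlas_topology A)"

lemma openin_atlas_topology:
  assumes "smooth_manifold A"
  shows "openin (atlas_topology A) S \<longleftrightarrow>
    S \<subseteq> points A \<and> (\<forall>(U, \<phi>)\<in>A. open (\<phi> ` (U \<inter> S)))"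
proof -
  let ?P = "\<lambda>S. S \<subseteq> points A \<and> (\<forall>(U, \<phi>)\<in>A. open (\<phi> ` (U \<inter> S)))"
  have inj: "inj_on \<phi> U" if "(U, \<phi>) \<in> A" for U \<phi>
    using assms that unfolding smooth_manifold_def by blast
  have "istopology ?P"
    unfolding istopology_def
  proof (intro conjI allI impI)
    fix S T assume S: "?P S" and T: "?P T"
    show "S \<inter> T \<subseteq> points A" using S by blast
    show "\<forall>(U, \<phi>)\<in>A. open (\<phi> ` (U \<inter> (S \<inter> T)))"
    proof clarify
      fix U \<phi> assume c: "(U, \<phi>) \<in> A"
      have "\<phi> ` (U \<inter> (S \<inter> T)) = \<phi> ` (U \<inter> S) \<inter> \<phi> ` (U \<inter> T)"
        using inj[OF c] by (auto simp: inj_on_def)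
      then show "open (\<phi> ` (U \<inter> (S \<inter> T)))" using S T c by auto
    qed
  next
    fix \<K> assume K: "\<forall>S\<in>\<K>. ?P S"
    show "\<Union>\<K> \<subseteq> points A" using K by blast
    show "\<forall>(U, \<phi>)\<in>A. open (\<phi> ` (U \<inter> \<Union>\<K>))"
    proof clarify
      fix U \<phi> assume c: "(U, \<phi>) \<in> A"
      have "\<phi> ` (U \<inter> \<Union>\<K>) = (\<Union>S\<in>\<K>. \<phi> ` (U \<inter> S))" by blast
      moreover have "open (\<phi> ` (U \<inter> S))" if "S \<in> \<K>" for S using K c that by blast
      ultimately show "open (\<phi> ` (U \<inter> \<Union>\<K>))" by (simp add: open_UN)
    qed
  qed
  then show ?thesis
    by (simp add: atlas_topology_def topology_inverse')
qed

text \<open>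
  The openness clause expresses continuity of \<open>f\<close>, and makes sure that the coordinate expression
  is considered on an open set.
\<close>

definition smooth_map ::
  "('a, 'e::real_normed_vector) chart set \<Rightarrow> ('b, 'f::real_normed_vector) chart set \<Rightarrow> ('a \<Rightarrow> 'b) \<Rightarrow> bool"
  where
  "smooth_map A B f \<longleftrightarrow> f \<in> points A \<rightarrow> points B \<and>
     (\<forall>(U, \<phi>)\<in>A. \<forall>(V, \<psi>)\<in>B.
        open (\<phi> ` (U \<inter> f -` V)) \<and> smooth_on (\<phi> ` (U \<inter> f -` V)) (\<psi> \<circ> f \<circ> inv_into U \<phi>))"

definition prod_atlas ::
  "('a, 'e) chart set \<Rightarrow> ('b, 'f) chart set \<Rightarrow> ('a \<times> 'b, 'e \<times> 'f) chart set" where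
  "prod_atlas A B = (\<lambda>((U, \<phi>), (V, \<psi>)). (U \<times> V, map_prod \<phi> \<psi>)) ` (A \<times> B)"

text \<open>Used for open \<open>S\<close> only.\<close>

definition std_atlas :: "'e set \<Rightarrow> ('e, 'e) chart set" where
  "std_atlas S = {(S, \<lambda>x. x)}"

definition smooth_functions :: "('a, 'e::real_normed_vector) chart set \<Rightarrow> ('a \<Rightarrow> real) set" where
  "smooth_functions A = {f. smooth_map A (std_atlas UNIV) f}"


section \<open>Tangent vectors\<close>

text \<open>
  A tangent vector at \<open>p\<close> is the velocity of a smooth curve through \<open>p\<close>, regarded as the
  operator of differentiating smooth functions along this curve. Operators are set to \<open>0\<close> outside
  the smooth functions, so that equality of tangent vectors is equality of operators. Vector space
  operations are pointwise.
\<close>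

type_synonym 'a tangent = "('a \<Rightarrow> real) \<Rightarrow> real"

definition velocity :: "('a, 'e::real_normed_vector) chart set \<Rightarrow> (real \<Rightarrow> 'a) \<Rightarrow> 'a tangent" where
  "velocity A \<gamma> = (\<lambda>f. if f \<in> smooth_functions A then deriv (\<lambda>t. f (\<gamma> t)) 0 else 0)"

definition tangent_space :: "('a, 'e::real_normed_vector) chart set \<Rightarrow> 'a \<Rightarrow> 'a tangent set" where
  "tangent_space A p = {velocity A \<gamma> | \<gamma> \<epsilon>.
     \<epsilon> > 0 \<and> smooth_map (std_atlas {-\<epsilon><..<\<epsilon>}) A \<gamma> \<and> \<gamma> 0 = p}"

text \<open>Here \<open>B\<close> is the atlas of the target; the point is implicit in \<open>X\<close>.\<close>

definition differential ::
  "('b, 'f::real_normed_vector) chart set \<Rightarrow> ('a \<Rightarrow> 'b) \<Rightarrow> 'a tangent \<Rightarrow> 'b tangent" where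
  "differential B F X = (\<lambda>f. if f \<in> smooth_functions B then X (f \<circ> F) else 0)"

definition vector_field_bracket ::
  "('a \<Rightarrow> 'a tangent) \<Rightarrow> ('a \<Rightarrow> 'a tangent) \<Rightarrow> 'a \<Rightarrow> 'a tangent" where
  "vector_field_bracket V W = (\<lambda>p f. V p (\<lambda>q. W q f) - W p (\<lambda>q. V q f))"

definition inner_product_on :: "'a tangent set \<Rightarrow> ('a tangent \<Rightarrow> 'a tangent \<Rightarrow> real) \<Rightarrow> bool" where
  "inner_product_on T ip \<longleftrightarrow>
     (\<forall>X\<in>T. \<forall>Y\<in>T. \<forall>Z\<in>T. ip (\<lambda>f. X f + Y f) Z = ip X Z + ip Y Z) \<and>
     (\<forall>c. \<forall>X\<in>T. \<forall>Y\<in>T. ip (\<lambda>f. c * X f) Y = c * ip X Y) \<and>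
     (\<forall>X\<in>T. \<forall>Y\<in>T. ip X Y = ip Y X) \<and>
     (\<forall>X\<in>T. X \<noteq> (\<lambda>f. 0) \<longrightarrow> ip X X > 0)"


section \<open>Lie groups and their Lie algebras\<close>

record ('a, 'e) lie_struct = "'a monoid" +
  atlas :: "('a, 'e) chart set"

locale lie_group = group G for G :: "('a, 'e::real_inner) lie_struct" (structure) +
  assumes smooth_manifold_atlas: "smooth_manifold (atlas G)"
    and points_atlas: "points (atlas G) = carrier G"
    and smooth_mult: "smooth_map (prod_atlas (atlas G) (atlas G)) (atlas G) (\<lambda>(x, y). x \<otimes> y)"
    and smooth_inv: "smooth_map (atlas G) (atlas G) (\<lambda>x. inv x)"

definition lie_algebra :: "('a, 'e::real_inner) lie_struct \<Rightarrow> 'a tangent set" where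
  "lie_algebra G = tangent_space (atlas G) \<one>\<^bsub>G\<^esub>"

definition left_invariant_field ::
  "('a, 'e::real_inner) lie_struct \<Rightarrow> 'a tangent \<Rightarrow> 'a \<Rightarrow> 'a tangent" where
  "left_invariant_field G X = (\<lambda>p. differential (atlas G) (\<lambda>q. p \<otimes>\<^bsub>G\<^esub> q) X)"

definition lie_bracket ::
  "('a, 'e::real_inner) lie_struct \<Rightarrow> 'a tangent \<Rightarrow> 'a tangent \<Rightarrow> 'a tangent" where
  "lie_bracket G X Y =
     vector_field_bracket (left_invariant_field G X) (left_invariant_field G Y) \<one>\<^bsub>G\<^esub>"


section \<open>Cyclic left-invariant metrics\<close>

text \<open>The left-invariant metric determined by \<open>ip\<close>, as a family of forms indexed by the points.\<close>

definition left_invariant_metric ::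
  "('a, 'e::real_inner) lie_struct \<Rightarrow> ('a tangent \<Rightarrow> 'a tangent \<Rightarrow> real) \<Rightarrow>
   'a \<Rightarrow> 'a tangent \<Rightarrow> 'a tangent \<Rightarrow> real" where
  "left_invariant_metric G ip = (\<lambda>p X Y.
     ip (differential (atlas G) (\<lambda>q. inv\<^bsub>G\<^esub> p \<otimes>\<^bsub>G\<^esub> q) X)
        (differential (atlas G) (\<lambda>q. inv\<^bsub>G\<^esub> p \<otimes>\<^bsub>G\<^esub> q) Y))"

definition cyclic_metric ::
  "('a, 'e::real_inner) lie_struct \<Rightarrow> ('a \<Rightarrow> 'a tangent \<Rightarrow> 'a tangent \<Rightarrow> real) \<Rightarrow> bool" where
  "cyclic_metric G m \<longleftrightarrow>
     (\<forall>X\<in>lie_algebra G. \<forall>Y\<in>lie_algebra G. \<forall>Z\<in>lie_algebra G.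
        m \<one>\<^bsub>G\<^esub> (lie_bracket G X Y) Z + m \<one>\<^bsub>G\<^esub> (lie_bracket G Y Z) X
          + m \<one>\<^bsub>G\<^esub> (lie_bracket G Z X) Y = 0)"

definition defines_cyclic_metric ::
  "('a, 'e::real_inner) lie_struct \<Rightarrow> ('a tangent \<Rightarrow> 'a tangent \<Rightarrow> real) \<Rightarrow> bool" where
  "defines_cyclic_metric G ip \<longleftrightarrow>
     inner_product_on (lie_algebra G) ip \<and> cyclic_metric G (left_invariant_metric G ip)"

definition selfadjoint_on ::
  "'a tangent set \<Rightarrow> ('a tangent \<Rightarrow> 'a tangent \<Rightarrow> real) \<Rightarrow> ('a tangent \<Rightarrow> 'a tangent) \<Rightarrow> bool" where
  "selfadjoint_on T ip D \<longleftrightarrow> (\<forall>X\<in>T. \<forall>Y\<in>T. ip (D X) Y = ip X (D Y))"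


section \<open>Semidirect products\<close>

text \<open>
  A homomorphism \<open>\<pi>\<close> into the automorphism group is called smooth if the corresponding action
  is smooth. It follows that each \<open>\<pi> g\<close> is a diffeomorphism, hence a Lie group automorphism.
\<close>

definition smooth_action ::
  "('a, 'e::real_inner) lie_struct \<Rightarrow> ('b, 'f::real_inner) lie_struct \<Rightarrow> ('a \<Rightarrow> 'b \<Rightarrow> 'b) \<Rightarrow> bool" where
  "smooth_action G\<^sub>1 G\<^sub>2 \<pi> \<longleftrightarrow> \<pi> \<in> hom G\<^sub>1 (AutoGroup G\<^sub>2) \<and>
     smooth_map (prod_atlas (atlas G\<^sub>1) (atlas G\<^sub>2)) (atlas G\<^sub>2) (\<lambda>(g, h). \<pi> g h)"

definition semidirect ::
  "('a, 'e::real_inner) lie_struct \<Rightarrow> ('a \<Rightarrow> 'b \<Rightarrow> 'b) \<Rightarrow> ('b, 'f::real_inner) lie_struct \<Rightarrow>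
   ('a \<times> 'b, 'e \<times> 'f) lie_struct" where
  "semidirect G\<^sub>1 \<pi> G\<^sub>2 =
     \<lparr>carrier = carrier G\<^sub>1 \<times> carrier G\<^sub>2,
      mult = (\<lambda>(g\<^sub>1, g\<^sub>2) (h\<^sub>1, h\<^sub>2). (g\<^sub>1 \<otimes>\<^bsub>G\<^sub>1\<^esub> h\<^sub>1, g\<^sub>2 \<otimes>\<^bsub>G\<^sub>2\<^esub> \<pi> g\<^sub>1 h\<^sub>2)),
      one = (\<one>\<^bsub>G\<^sub>1\<^esub>, \<one>\<^bsub>G\<^sub>2\<^esub>),
      atlas = prod_atlas (atlas G\<^sub>1) (atlas G\<^sub>2)\<rparr>"

text \<open>
  An automorphism of \<open>G\<^sub>2\<close> acts on the Lie algebra of \<open>G\<^sub>2\<close> by its differential at the identity.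
  The operator \<open>\<pi>\<^sub>* X\<close> sends \<open>Y\<close> to the derivative at \<open>\<one>\<close>, in the direction \<open>X\<close>, of
  \<open>g \<mapsto> d(\<pi> g) Y\<close>. This is a map into the finite-dimensional Lie algebra of \<open>G\<^sub>2\<close>, on which
  evaluation at \<open>f\<close> is linear, so that it can be differentiated for each \<open>f\<close> separately.
\<close>

definition action_derivation ::
  "('b, 'f::real_inner) lie_struct \<Rightarrow> ('a \<Rightarrow> 'b \<Rightarrow> 'b) \<Rightarrow> 'a tangent \<Rightarrow> 'b tangent \<Rightarrow> 'b tangent" where
  "action_derivation G\<^sub>2 \<pi> X Y = (\<lambda>f. X (\<lambda>g. differential (atlas G\<^sub>2) (\<pi> g) Y f))"

text \<open>
  The tangent space of a product is identified with the product of the tangent spaces by the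
  differentials of the two projections.
\<close>

definition product_inner ::
  "('a, 'e::real_inner) lie_struct \<Rightarrow> ('b, 'f::real_inner) lie_struct \<Rightarrow>
   ('a tangent \<Rightarrow> 'a tangent \<Rightarrow> real) \<Rightarrow> ('b tangent \<Rightarrow> 'b tangent \<Rightarrow> real) \<Rightarrow>
   ('a \<times> 'b) tangent \<Rightarrow> ('a \<times> 'b) tangent \<Rightarrow> real" where
  "product_inner G\<^sub>1 G\<^sub>2 ip\<^sub>1 ip\<^sub>2 = (\<lambda>X Y.
     ip\<^sub>1 (differential (atlas G\<^sub>1) fst X) (differential (atlas G\<^sub>1) fst Y) +
     ip\<^sub>2 (differential (atlas G\<^sub>2) snd X) (differential (atlas G\<^sub>2) snd Y))"

end

theory Submission
  imports Defs
begin

text \<open>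
  Decompose vectors of the Lie algebra of the semidirect product as \<open>X = (X\<^sub>1, X\<^sub>2)\<close>. By the bracket
  formula, the cyclic sum of \<open>\<langle>[X, Y], Z\<rangle>\<close> is the cyclic sum for the first components, plus the cyclic
  sum for the second components, plus six terms of the form \<open>\<plusminus>\<langle>\<pi>\<^sub>*(X\<^sub>1) Y\<^sub>2, Z\<^sub>2\<rangle>\<close>. If the derivations are
  selfadjoint, these six cancel in pairs, so cyclicity of the factors gives cyclicity of the product.
  Conversely, vectors tangent to a single factor yield cyclicity of that factor, and the choice
  \<open>(X\<^sub>1, 0)\<close>, \<open>(0, Y\<^sub>2)\<close>, \<open>(0, Z\<^sub>2)\<close> leaves exactly
  \<open>\<langle>\<pi>\<^sub>*(X\<^sub>1) Y\<^sub>2, Z\<^sub>2\<rangle> - \<langle>\<pi>\<^sub>*(X\<^sub>1) Z\<^sub>2, Y\<^sub>2\<rangle> = 0\<close>.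

  The work lies in the bracket formula and in showing that brackets and the vectors \<open>\<pi>\<^sub>*(X\<^sub>1) Y\<^sub>2\<close> belong
  to the Lie algebras, for these are spaces of velocities of curves, and the inner products are additive
  only there. Both rest on rewriting the bracket as an iterated derivative,
  \<open>[X, Y] f = X\<^sub>p Y\<^sub>q f(p q) - Y\<^sub>p X\<^sub>q f(p q)\<close> (\<open>smooth_monoid.lie_bracket_apply\<close>), and likewise
  \<open>(\<pi>\<^sub>*(X) Y) f = X\<^sub>g Y\<^sub>h f(\<pi> g h)\<close>. For the multiplication of the semidirect product, splitting the
  outer derivative along the two factors gives the bracket formula (\<open>lie_bracket_fst\<close> and
  \<open>lie_bracket_snd\<close> in the locale \<open>smooth_semidirect\<close>). In charts, the second-order chain rule
  (\<open>mixed_derivative_in_charts\<close>) writes an iterated derivative \<open>X\<^sub>p Y\<^sub>q f(F(p, q))\<close> as a first derivative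
  of \<open>f\<close> plus a second derivative of \<open>f\<close> in the directions of the partial derivatives of \<open>F\<close>. The latter
  cancels in the bracket by symmetry of second derivatives (\<open>dir_deriv_commute\<close>), and vanishes for the
  action because every \<open>\<pi> g\<close> fixes the identity.
\<close>

section \<open>Smooth maps between open sets\<close>

abbreviation dir_deriv :: "('e::real_normed_vector \<Rightarrow> 'f::real_normed_vector) \<Rightarrow> 'e \<Rightarrow> 'e \<Rightarrow> 'f" where
  "dir_deriv f x v \<equiv> frechet_derivative f (at x) v"

lemma dir_derivI: "(f has_derivative f') (at x) \<Longrightarrow> dir_deriv f x = f'"
  by (simp add: frechet_derivative_at [symmetric])

lemma dir_deriv_cong:
  assumes "open S" "x \<in> S" "\<And>y. y \<in> S \<Longrightarrow> f y = g y"
  shows "dir_deriv f x = dir_deriv g x"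
proof -
  have "(f has_derivative f') (at x) \<longleftrightarrow> (g has_derivative f') (at x)" for f'
    using has_derivative_transform_within_open[of f f' x UNIV S g]
      has_derivative_transform_within_open[of g f' x UNIV S f] assms by auto
  then show ?thesis by (simp add: frechet_derivative_def)
qed

lemma Ck_on_Suc_D:
  assumes "Ck_on (Suc k) S f"
  shows "x \<in> S \<Longrightarrow> (f has_derivative dir_deriv f x) (at x)"
    and "Ck_on k S (\<lambda>x. dir_deriv f x v)"
  using assms frechet_derivative_works by auto

lemma Ck_on_cong_imp:
  assumes "open S" "\<And>x. x \<in> S \<Longrightarrow> f x = g x" "Ck_on k S f"
  shows "Ck_on k S g"
  using assms(2,3)
proof (induction k arbitrary: f g)
  case 0
  then show ?case using continuous_on_cong by force
next
  case (Suc k)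
  have 1: "g differentiable (at x)" if "x \<in> S" for x
    using has_derivative_transform_within_open[OF Ck_on_Suc_D(1)[OF Suc.prems(2) that] assms(1) that Suc.prems(1)]
    by (auto simp: differentiable_def)
  have "Ck_on k S (\<lambda>x. dir_deriv g x v)" for v
  proof (rule Suc.IH)
    show "Ck_on k S (\<lambda>x. dir_deriv f x v)" using Suc.prems by simp
    show "dir_deriv f x v = dir_deriv g x v" if "x \<in> S" for x
      using dir_deriv_cong[OF assms(1) that Suc.prems(1)] by simp
  qed
  with 1 show ?case by simp
qed

lemma Ck_on_Suc_I:
  assumes "open S" "\<And>x. x \<in> S \<Longrightarrow> (f has_derivative f' x) (at x)"
    and "\<And>v. Ck_on k S (\<lambda>x. f' x v)"
  shows "Ck_on (Suc k) S f"
proof -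
  have "Ck_on k S (\<lambda>x. dir_deriv f x v)" for v
    using dir_derivI[OF assms(2)] by (intro Ck_on_cong_imp[OF assms(1) _ assms(3)[of v]]) simp
  then show ?thesis using assms(2) by (auto simp: differentiable_def)
qed

lemma Ck_on_Suc_imp: "Ck_on (Suc k) S f \<Longrightarrow> Ck_on k S f"
proof (induction k arbitrary: f)
  case 0
  then show ?case
    by (auto intro!: continuous_at_imp_continuous_on differentiable_imp_continuous_within)
next
  case (Suc k)
  show ?case
    using Suc.prems Suc.IH[OF Ck_on_Suc_D(2)[OF Suc.prems]] by simp
qed

lemma Ck_on_subset: "Ck_on k S f \<Longrightarrow> T \<subseteq> S \<Longrightarrow> Ck_on k T f"
  by (induction k arbitrary: f) (auto intro: continuous_on_subset)

lemma Ck_on_local: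
  assumes "\<And>x. x \<in> S \<Longrightarrow> \<exists>T. open T \<and> x \<in> T \<and> Ck_on k T f"
  shows "Ck_on k S f"
  using assms
proof (induction k arbitrary: f)
  case 0
  have "isCont f x" if "x \<in> S" for x
    using 0[OF that] continuous_on_eq_continuous_at by auto
  then show ?case by (simp add: continuous_at_imp_continuous_on)
next
  case (Suc k)
  have "Ck_on k S (\<lambda>x. dir_deriv f x v)" for v
  proof (rule Suc.IH)
    fix x assume "x \<in> S"
    from Suc.prems[OF this] obtain T where "open T" "x \<in> T" "Ck_on (Suc k) T f" by blast
    then show "\<exists>T. open T \<and> x \<in> T \<and> Ck_on k T (\<lambda>x. dir_deriv f x v)"
      using Ck_on_Suc_D(2) by blast
  qed
  moreover have "f differentiable (at x)" if "x \<in> S" for x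
    using Suc.prems[OF that] by auto
  ultimately show ?case by simp
qed

lemma Ck_on_const: "open S \<Longrightarrow> Ck_on k S (\<lambda>x. c)"
proof (induction k arbitrary: c)
  case (Suc k)
  show ?case by (rule Ck_on_Suc_I[where f'="\<lambda>x v. 0"]) (use Suc in auto)
qed simp

lemma Ck_on_affine:
  assumes "open S" "bounded_linear L"
  shows "Ck_on k S (\<lambda>x. c + L x)"
proof (cases k)
  case 0
  then show ?thesis
    using bounded_linear.continuous_on[OF assms(2) continuous_on_id] by (simp add: continuous_on_add)
next
  case (Suc j)
  have "((\<lambda>x. c + L x) has_derivative L) (at x)" for x
    using bounded_linear_imp_has_derivative[OF assms(2)] by (auto intro!: derivative_eq_intros)
  then show ?thesis unfolding Suc
    by (intro Ck_on_Suc_I[where f'="\<lambda>x v. L v"] Ck_on_const assms(1)) auto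
qed

lemma Ck_on_linear_compose:
  assumes "open S" "bounded_linear L" "Ck_on k S f"
  shows "Ck_on k S (\<lambda>x. L (f x))"
  using assms(3)
proof (induction k arbitrary: f)
  case 0
  then show ?case using assms(2) by (simp add: bounded_linear.continuous_on)
next
  case (Suc k)
  show ?case
    by (rule Ck_on_Suc_I[where f'="\<lambda>x v. L (dir_deriv f x v)"])
      (rule assms(1) bounded_linear.has_derivative[OF assms(2)] Suc.IH
        Ck_on_Suc_D[OF Suc.prems] | assumption)+
qed

lemma Ck_on_add:
  assumes "open S" "Ck_on k S f" "Ck_on k S g"
  shows "Ck_on k S (\<lambda>x. f x + g x)"
  using assms(2,3)
proof (induction k arbitrary: f g)
  case 0
  then show ?case by (simp add: continuous_on_add)
next
  case (Suc k)
  show ?case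
    by (rule Ck_on_Suc_I[where f'="\<lambda>x v. dir_deriv f x v + dir_deriv g x v"])
      (rule assms(1) has_derivative_add Suc.IH
        Ck_on_Suc_D[OF Suc.prems(1)] Ck_on_Suc_D[OF Suc.prems(2)] | assumption)+
qed

lemma Ck_on_sum:
  assumes "open S" "\<And>i. i \<in> I \<Longrightarrow> Ck_on k S (f i)"
  shows "Ck_on k S (\<lambda>x. \<Sum>i\<in>I. f i x)"
  using assms(2)
  by (induction I rule: infinite_finite_induct) (auto intro: Ck_on_add Ck_on_const assms(1))

lemma Ck_on_scaleR:
  fixes c :: "'e::real_normed_vector \<Rightarrow> real"
  assumes "open S" "Ck_on k S c" "Ck_on k S f"
  shows "Ck_on k S (\<lambda>x. c x *\<^sub>R f x)"
  using assms(2,3)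
proof (induction k arbitrary: c f)
  case 0
  then show ?case by (simp add: continuous_on_scaleR)
next
  case (Suc k)
  show ?case
  proof (rule Ck_on_Suc_I[OF assms(1)])
    show "((\<lambda>x. c x *\<^sub>R f x) has_derivative (\<lambda>v. c x *\<^sub>R dir_deriv f x v + dir_deriv c x v *\<^sub>R f x)) (at x)"
      if "x \<in> S" for x
      using has_derivative_scaleR[OF Ck_on_Suc_D(1)[OF Suc.prems(1) that] Ck_on_Suc_D(1)[OF Suc.prems(2) that]] .
    show "Ck_on k S (\<lambda>x. c x *\<^sub>R dir_deriv f x v + dir_deriv c x v *\<^sub>R f x)" for v
      by (intro Ck_on_add assms(1) Suc.IH Ck_on_Suc_imp[OF Suc.prems(1)] Ck_on_Suc_imp[OF Suc.prems(2)]
          Ck_on_Suc_D(2)[OF Suc.prems(1)] Ck_on_Suc_D(2)[OF Suc.prems(2)])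
  qed
qed

lemma Ck_on_Pair:
  assumes "open S" "Ck_on k S f" "Ck_on k S g"
  shows "Ck_on k S (\<lambda>x. (f x, g x))"
proof -
  have "Ck_on k S (\<lambda>x. (f x, 0) + (0, g x))"
    by (intro Ck_on_add assms
        Ck_on_linear_compose[of _ "\<lambda>u. (u, 0)"] Ck_on_linear_compose[of _ "\<lambda>u. (0, u)"]
        bounded_linear_Pair bounded_linear_ident bounded_linear_zero)
  then show ?thesis by simp
qed

text \<open>
  Finite dimensionality enters the calculus through an expansion of this kind: its coefficients are
  bounded linear functions of the expanded vector, so they are smooth whenever the vector is.
\<close>

definition dual_frame :: "'e::real_inner set \<Rightarrow> ('e \<Rightarrow> 'e) \<Rightarrow> bool" where
  "dual_frame B \<beta> \<longleftrightarrow> (\<forall>v. (\<Sum>b\<in>B. (v \<bullet> \<beta> b) *\<^sub>R b) = v)"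

text \<open>
  An orthogonal spanning set serves as frame. A zero vector in it does no harm, since its term in the
  expansion vanishes.
\<close>

lemma dual_frame_exists:
  fixes B :: "'e::real_inner set"
  assumes "finite B" "span B = UNIV"
  obtains C \<beta> where "dual_frame (C :: 'e set) \<beta>"
proof -
  obtain C where C: "finite C" "span C = span B" "pairwise orthogonal C"
    using basis_orthogonal[OF assms(1)] by blast
  define \<beta> where "\<beta> b = inverse (b \<bullet> b) *\<^sub>R b" for b :: 'e
  have "(\<Sum>b\<in>C. (v \<bullet> \<beta> b) *\<^sub>R b) = v" for v
  proof -
    let ?d = "v - (\<Sum>b\<in>C. (v \<bullet> \<beta> b) *\<^sub>R b)"
    have orth: "orthogonal ?d c" if c: "c \<in> C" for c
    proof -
      have "(\<Sum>b\<in>C. ((v \<bullet> \<beta> b) *\<^sub>R b) \<bullet> c) = (\<Sum>b\<in>C. if b = c then v \<bullet> c else 0)"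
      proof (rule sum.cong[OF refl])
        fix b assume "b \<in> C"
        then have "b \<noteq> c \<Longrightarrow> b \<bullet> c = 0"
          using C(3) c by (auto simp: pairwise_def orthogonal_def)
        then show "((v \<bullet> \<beta> b) *\<^sub>R b) \<bullet> c = (if b = c then v \<bullet> c else 0)"
          by (cases "c = 0") (auto simp: \<beta>_def)
      qed
      then show ?thesis
        using c C(1) by (simp add: orthogonal_def inner_diff_left inner_sum_left)
    qed
    have "?d \<in> span C" using C(2) assms(2) by simp
    then have "orthogonal ?d ?d" by (rule orthogonal_to_span) (rule orth)
    then show ?thesis by (simp add: orthogonal_self)
  qed
  then show thesis using that[of C \<beta>] by (simp add: dual_frame_def)
qed

lemma linear_dual_frame:
  assumes "dual_frame B \<beta>" "linear L"
  shows "L v = (\<Sum>b\<in>B. (v \<bullet> \<beta> b) *\<^sub>R L b)"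
proof -
  have "L v = L (\<Sum>b\<in>B. (v \<bullet> \<beta> b) *\<^sub>R b)" using assms(1) by (simp add: dual_frame_def)
  then show ?thesis using assms(2) by (simp add: linear_sum linear_scale)
qed

text \<open>
  \<^const>\<open>Ck_on\<close> differentiates in one constant direction at a time, whereas the chain rule applies the
  derivative of \<open>g\<close> to the moving vector \<open>dir_deriv f x v\<close>. Expanding that vector in a frame leaves
  constant directions for \<open>g\<close> and puts the motion into scalar coefficients, so that the induction
  hypothesis applies to each term.
\<close>

lemma Ck_on_compose:
  fixes f :: "'e::real_normed_vector \<Rightarrow> 'f::real_inner"
  assumes fr: "dual_frame (B :: 'f set) \<beta>" and S: "open S" and T: "f ` S \<subseteq> T"
    and "Ck_on k S f" "Ck_on k T g"
  shows "Ck_on k S (\<lambda>x. g (f x))"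
  using assms(4,5)
proof (induction k arbitrary: g)
  case 0
  then show ?case using T by (simp add: continuous_on_compose2)
next
  case (Suc k)
  show ?case
  proof (rule Ck_on_Suc_I[OF S])
    fix x assume x: "x \<in> S"
    then have fx: "f x \<in> T" using T by blast
    have g: "(g has_derivative dir_deriv g (f x)) (at (f x))" by (rule Ck_on_Suc_D(1)[OF Suc.prems(2) fx])
    have "((\<lambda>x. g (f x)) has_derivative (\<lambda>v. dir_deriv g (f x) (dir_deriv f x v))) (at x)"
      by (rule has_derivative_compose[OF Ck_on_Suc_D(1)[OF Suc.prems(1) x] g])
    moreover have "dir_deriv g (f x) (dir_deriv f x v) = (\<Sum>b\<in>B. (dir_deriv f x v \<bullet> \<beta> b) *\<^sub>R dir_deriv g (f x) b)" for v
      by (rule linear_dual_frame[OF fr has_derivative_linear[OF g]])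
    ultimately show "((\<lambda>x. g (f x)) has_derivative
        (\<lambda>v. \<Sum>b\<in>B. (dir_deriv f x v \<bullet> \<beta> b) *\<^sub>R dir_deriv g (f x) b)) (at x)"
      by simp
  next
    fix v
    have "Ck_on k S (\<lambda>x. dir_deriv f x v \<bullet> \<beta> b)" for b
      by (rule Ck_on_linear_compose[OF S bounded_linear_inner_left Ck_on_Suc_D(2)[OF Suc.prems(1)]])
    moreover have "Ck_on k S (\<lambda>x. dir_deriv g (f x) b)" for b
      by (rule Suc.IH[OF Ck_on_Suc_imp[OF Suc.prems(1)] Ck_on_Suc_D(2)[OF Suc.prems(2)]])
    ultimately show "Ck_on k S (\<lambda>x. \<Sum>b\<in>B. (dir_deriv f x v \<bullet> \<beta> b) *\<^sub>R dir_deriv g (f x) b)"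
      by (intro Ck_on_sum Ck_on_scaleR S)
  qed
qed

lemma smooth_on_cong_imp:
  "open S \<Longrightarrow> (\<And>x. x \<in> S \<Longrightarrow> f x = g x) \<Longrightarrow> smooth_on S f \<Longrightarrow> smooth_on S g"
  unfolding smooth_on_def by (intro allI Ck_on_cong_imp[of S f g]) auto

lemma smooth_on_has_derivative:
  assumes "smooth_on S f" "x \<in> S"
  shows "(f has_derivative dir_deriv f x) (at x)"
  using assms Ck_on_Suc_D(1)[of 0 S f x] by (simp add: smooth_on_def del: Ck_on.simps)

lemma smooth_on_dir_deriv: "smooth_on S f \<Longrightarrow> smooth_on S (\<lambda>x. dir_deriv f x v)"
  by (simp add: smooth_on_def Ck_on_Suc_D(2) del: Ck_on.simps)

lemma smooth_on_continuous: "smooth_on S f \<Longrightarrow> continuous_on S f"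
  using Ck_on.simps(1) unfolding smooth_on_def by blast

lemma smooth_on_subset: "smooth_on S f \<Longrightarrow> T \<subseteq> S \<Longrightarrow> smooth_on T f"
  unfolding smooth_on_def using Ck_on_subset[of _ S f T] by blast

lemma smooth_on_local:
  assumes "\<And>x. x \<in> S \<Longrightarrow> \<exists>T. open T \<and> x \<in> T \<and> smooth_on T f"
  shows "smooth_on S f"
  unfolding smooth_on_def
proof (rule allI, rule Ck_on_local)
  fix k x assume "x \<in> S"
  then show "\<exists>T. open T \<and> x \<in> T \<and> Ck_on k T f"
    using assms unfolding smooth_on_def by blast
qed

lemma smooth_on_affine: "open S \<Longrightarrow> bounded_linear L \<Longrightarrow> smooth_on S (\<lambda>x. c + L x)"
  by (simp add: smooth_on_def Ck_on_affine del: Ck_on.simps)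

lemma smooth_on_linear: "open S \<Longrightarrow> bounded_linear L \<Longrightarrow> smooth_on S L"
  using smooth_on_affine[of S L 0] by simp

lemma smooth_on_const: "open S \<Longrightarrow> smooth_on S (\<lambda>x. c)"
  by (simp add: smooth_on_def Ck_on_const del: Ck_on.simps)

lemma smooth_on_Pair:
  "open S \<Longrightarrow> smooth_on S f \<Longrightarrow> smooth_on S g \<Longrightarrow> smooth_on S (\<lambda>x. (f x, g x))"
  by (simp add: smooth_on_def Ck_on_Pair del: Ck_on.simps)

lemma smooth_on_compose:
  fixes f :: "'e::real_normed_vector \<Rightarrow> 'f::real_inner"
  assumes "finite (B :: 'f set)" "span B = UNIV" "open S" "f ` S \<subseteq> T" "smooth_on S f" "smooth_on T g"
  shows "smooth_on S (\<lambda>x. g (f x))"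
proof -
  obtain C \<beta> where fr: "dual_frame (C :: 'f set) \<beta>" using dual_frame_exists[OF assms(1,2)] .
  have "Ck_on k S (\<lambda>x. g (f x))" for k
    by (rule Ck_on_compose[OF fr assms(3,4)]) (use assms(5,6) in \<open>simp_all add: smooth_on_def\<close>)
  then show ?thesis by (simp add: smooth_on_def)
qed

lemma dir_deriv_compose:
  assumes "(f has_derivative dir_deriv f x) (at x)" "(g has_derivative dir_deriv g (f x)) (at (f x))"
  shows "dir_deriv (\<lambda>x. g (f x)) x v = dir_deriv g (f x) (dir_deriv f x v)"
  by (simp add: dir_derivI[OF has_derivative_compose[OF assms]])

text \<open>
  Differentiating \<open>Df(h y)(D\<^sub>w h(y))\<close> once more in direction \<open>u\<close> gives one term from the moving vector
  \<open>D\<^sub>w h(y)\<close> and one from the moving base point \<open>h y\<close>. The first term is a first derivative of \<open>f\<close>; the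
  second one depends on \<open>h\<close> only through its value and its first derivatives at \<open>x\<close>, and this is
  why it cancels in brackets of vector fields.
\<close>

lemma second_order_chain_rule:
  fixes h :: "'e::real_normed_vector \<Rightarrow> 'f::real_inner"
  assumes B: "finite (B :: 'f set)" "span B = UNIV"
    and S: "open S" "h ` S \<subseteq> T" "x \<in> S" and "open T"
    and h: "smooth_on S h" and f: "smooth_on T f"
  shows "dir_deriv (\<lambda>y. dir_deriv (\<lambda>y. f (h y)) y w) x u =
    dir_deriv f (h x) (dir_deriv (\<lambda>y. dir_deriv h y w) x u) +
    dir_deriv (\<lambda>z. dir_deriv f z (dir_deriv h x w)) (h x) (dir_deriv h x u)"
proof -
  obtain C \<beta> where fr: "dual_frame (C :: 'f set) \<beta>" using dual_frame_exists[OF B] .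
  have hT: "h y \<in> T" if "y \<in> S" for y using S that by auto
  have lin: "linear (dir_deriv f z)" if "z \<in> T" for z
    using smooth_on_has_derivative[OF f that] has_derivative_linear by blast
  let ?g = "\<lambda>y. dir_deriv h y w"
  have 1: "dir_deriv (\<lambda>y. f (h y)) y w = (\<Sum>b\<in>C. (?g y \<bullet> \<beta> b) *\<^sub>R dir_deriv f (h y) b)" if "y \<in> S" for y
    using dir_deriv_compose[OF smooth_on_has_derivative[OF h that] smooth_on_has_derivative[OF f hT[OF that]]]
      linear_dual_frame[OF fr lin[OF hT[OF that]], of "?g y"] by simp
  \<comment> \<open>With constant directions \<open>b\<close>, the product rule applies to each term of the expansion.\<close>
  let ?D = "\<lambda>b. dir_deriv (\<lambda>z. dir_deriv f z b) (h x)"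
  have Db: "((\<lambda>z. dir_deriv f z b) has_derivative ?D b) (at (h x))" for b
    by (rule smooth_on_has_derivative[OF smooth_on_dir_deriv[OF f] hT[OF S(3)]])
  have g': "(?g has_derivative dir_deriv ?g x) (at x)"
    by (rule smooth_on_has_derivative[OF smooth_on_dir_deriv[OF h] S(3)])
  have 2: "((\<lambda>y. \<Sum>b\<in>C. (?g y \<bullet> \<beta> b) *\<^sub>R dir_deriv f (h y) b) has_derivative
     (\<lambda>u. \<Sum>b\<in>C. (?g x \<bullet> \<beta> b) *\<^sub>R ?D b (dir_deriv h x u) +
        (dir_deriv ?g x u \<bullet> \<beta> b) *\<^sub>R dir_deriv f (h x) b)) (at x)"
    by (intro has_derivative_sum has_derivative_scaleR has_derivative_inner_left g'
       has_derivative_compose[OF smooth_on_has_derivative[OF h S(3)] Db])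
  have "((\<lambda>z. \<Sum>b\<in>C. (?g x \<bullet> \<beta> b) *\<^sub>R dir_deriv f z b) has_derivative
     (\<lambda>v. \<Sum>b\<in>C. (?g x \<bullet> \<beta> b) *\<^sub>R ?D b v)) (at (h x))"
    using Db by (intro has_derivative_sum has_derivative_scaleR_right)
  then have 3: "(\<Sum>b\<in>C. (?g x \<bullet> \<beta> b) *\<^sub>R ?D b v) = dir_deriv (\<lambda>z. dir_deriv f z (?g x)) (h x) v" for v
    by (simp add: dir_derivI dir_deriv_cong[OF \<open>open T\<close> hT[OF S(3)] linear_dual_frame[OF fr lin, of _ "?g x"]])
  have "dir_deriv (\<lambda>y. dir_deriv (\<lambda>y. f (h y)) y w) x u =
     (\<Sum>b\<in>C. (?g x \<bullet> \<beta> b) *\<^sub>R ?D b (dir_deriv h x u) + (dir_deriv ?g x u \<bullet> \<beta> b) *\<^sub>R dir_deriv f (h x) b)"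
    using dir_deriv_cong[OF S(1,3) 1] dir_derivI[OF 2] by simp
  then show ?thesis
    using linear_dual_frame[OF fr lin[OF hT[OF S(3)]], of "dir_deriv ?g x u"] 3
    by (simp add: sum.distrib add.commute)
qed

text \<open>
  Applying the mean value theorem first along \<open>u\<close> and then along \<open>w\<close> turns the second difference over a
  small parallelogram into a second derivative at an intermediate point.
\<close>

lemma second_difference_mean_value:
  fixes f :: "'e::real_normed_vector \<Rightarrow> real"
  assumes f: "smooth_on S f" and "0 < h"
    and S: "\<And>s t. \<lbrakk>0 \<le> s; s \<le> h; 0 \<le> t; t \<le> h\<rbrakk> \<Longrightarrow> x + s *\<^sub>R u + t *\<^sub>R w \<in> S"
  obtains s t where "0 < s" "s < h" "0 < t" "t < h"
    "f (x + h *\<^sub>R u + h *\<^sub>R w) - f (x + h *\<^sub>R u) - f (x + h *\<^sub>R w) + f x =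
       h * h * dir_deriv (\<lambda>y. dir_deriv f y u) (x + s *\<^sub>R u + t *\<^sub>R w) w"
proof -
  have D: "((\<lambda>s. g (a + s *\<^sub>R v)) has_real_derivative dir_deriv g (a + s *\<^sub>R v) v) (at s)"
    if g: "smooth_on S g" and "a + s *\<^sub>R v \<in> S" for g :: "'e \<Rightarrow> real" and a s v
  proof -
    have "((\<lambda>s. a + s *\<^sub>R v) has_derivative (\<lambda>s. s *\<^sub>R v)) (at s)"
      by (auto intro!: derivative_eq_intros)
    from has_derivative_compose[OF this smooth_on_has_derivative[OF that]]
    have "((\<lambda>s. g (a + s *\<^sub>R v)) has_derivative (\<lambda>s'. dir_deriv g (a + s *\<^sub>R v) (s' *\<^sub>R v))) (at s)" .
    moreover have "linear (dir_deriv g (a + s *\<^sub>R v))"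
      using smooth_on_has_derivative[OF that] has_derivative_linear by blast
    ultimately show ?thesis
      by (simp add: has_field_derivative_def linear_scale mult_commute_abs)
  qed
  let ?\<phi> = "\<lambda>s. f (x + h *\<^sub>R w + s *\<^sub>R u) - f (x + s *\<^sub>R u)"
  have "(?\<phi> has_real_derivative
      dir_deriv f (x + h *\<^sub>R w + s *\<^sub>R u) u - dir_deriv f (x + s *\<^sub>R u) u) (at s)"
    if "0 \<le> s" "s \<le> h" for s
    using S[OF that, of h] S[OF that, of 0] \<open>0 < h\<close>
    by (intro DERIV_diff D f) (simp_all add: algebra_simps)
  from MVT2[OF \<open>0 < h\<close> this] obtain s where s: "0 < s" "s < h"
    "?\<phi> h - ?\<phi> 0 = (h - 0) * (dir_deriv f (x + h *\<^sub>R w + s *\<^sub>R u) u - dir_deriv f (x + s *\<^sub>R u) u)"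
    by blast
  let ?\<psi> = "\<lambda>t. dir_deriv f (x + s *\<^sub>R u + t *\<^sub>R w) u"
  have "(?\<psi> has_real_derivative dir_deriv (\<lambda>y. dir_deriv f y u) (x + s *\<^sub>R u + t *\<^sub>R w) w) (at t)"
    if "0 \<le> t" "t \<le> h" for t
    using s S[of s t] that by (intro D smooth_on_dir_deriv f) auto
  from MVT2[OF \<open>0 < h\<close> this] obtain t where t: "0 < t" "t < h"
    "?\<psi> h - ?\<psi> 0 = (h - 0) * dir_deriv (\<lambda>y. dir_deriv f y u) (x + s *\<^sub>R u + t *\<^sub>R w) w"
    by blast
  show thesis
  proof (rule that[OF s(1,2) t(1,2)])
    show "f (x + h *\<^sub>R u + h *\<^sub>R w) - f (x + h *\<^sub>R u) - f (x + h *\<^sub>R w) + f x =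
       h * h * dir_deriv (\<lambda>y. dir_deriv f y u) (x + s *\<^sub>R u + t *\<^sub>R w) w"
      using s(3) t(3) by (simp add: algebra_simps)
  qed
qed

text \<open>
  The second difference is symmetric in \<open>u\<close> and \<open>w\<close>, so both second derivatives take the same value at
  points arbitrarily close to \<open>x\<close>; continuity does the rest.
\<close>

lemma dir_deriv_commute:
  fixes f :: "'e::real_normed_vector \<Rightarrow> real"
  assumes f: "smooth_on S f" and S: "open S" "x \<in> S"
  shows "dir_deriv (\<lambda>y. dir_deriv f y u) x w = dir_deriv (\<lambda>y. dir_deriv f y w) x u"
proof (rule ccontr)
  let ?P = "\<lambda>y. dir_deriv (\<lambda>y. dir_deriv f y u) y w" and ?Q = "\<lambda>y. dir_deriv (\<lambda>y. dir_deriv f y w) y u"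
  assume "?P x \<noteq> ?Q x"
  define e where "e = \<bar>?P x - ?Q x\<bar> / 2"
  have "e > 0" using \<open>?P x \<noteq> ?Q x\<close> by (simp add: e_def)
  have "continuous_on S ?P" "continuous_on S ?Q"
    by (intro smooth_on_continuous smooth_on_dir_deriv f)+
  then have "isCont ?P x" "isCont ?Q x"
    using S continuous_on_eq_continuous_at by blast+
  then have "(?P \<longlongrightarrow> ?P x) (nhds x)" "(?Q \<longlongrightarrow> ?Q x) (nhds x)"
    using tendsto_at_iff_tendsto_nhds[of ?P x] tendsto_at_iff_tendsto_nhds[of ?Q x]
    unfolding isCont_def by blast+
  from tendstoD[OF this(1) \<open>e > 0\<close>] tendstoD[OF this(2) \<open>e > 0\<close>]
  have "\<forall>\<^sub>F y in nhds x. y \<in> S \<and> dist (?P y) (?P x) < e \<and> dist (?Q y) (?Q x) < e"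
    by (intro eventually_conj eventually_nhds_in_open S)
  then obtain d where d: "d > 0"
    "\<And>y. dist y x < d \<Longrightarrow> y \<in> S \<and> dist (?P y) (?P x) < e \<and> dist (?Q y) (?Q x) < e"
    unfolding eventually_nhds_metric by blast
  \<comment> \<open>The summand 1 keeps \<open>N\<close> positive when \<open>u\<close> and \<open>w\<close> vanish; with side \<open>h\<close> the whole
     parallelogram lies within distance \<open>d\<close> of \<open>x\<close>.\<close>
  define N where "N = norm u + norm w + 1"
  define h where "h = d / N / 2"
  have "N > 0" by (simp add: N_def add_nonneg_pos)
  then have h: "h > 0" "h * N = d / 2" using d(1) by (simp_all add: h_def)
  have "h * (norm u + norm w) = h * N - h" by (simp add: N_def algebra_simps)
  then have hd: "h * norm u + h * norm w < d" using h d(1) by (simp add: distrib_left)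
  have near: "dist (x + s *\<^sub>R u + t *\<^sub>R w) x < d" if "0 \<le> s" "s \<le> h" "0 \<le> t" "t \<le> h" for s t
  proof -
    have "dist (x + s *\<^sub>R u + t *\<^sub>R w) x \<le> norm (s *\<^sub>R u) + norm (t *\<^sub>R w)"
      using norm_triangle_ineq[of "s *\<^sub>R u" "t *\<^sub>R w"] by (simp add: dist_norm add.assoc)
    also have "\<dots> \<le> h * norm u + h * norm w"
      using that by (auto intro!: add_mono mult_right_mono)
    finally show ?thesis using hd by simp
  qed
  obtain s t where 1: "0 < s" "s < h" "0 < t" "t < h"
    "f (x + h *\<^sub>R u + h *\<^sub>R w) - f (x + h *\<^sub>R u) - f (x + h *\<^sub>R w) + f x = h * h * ?P (x + s *\<^sub>R u + t *\<^sub>R w)"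
    using second_difference_mean_value[OF f h(1), of x u w] near d(2) by blast
  have near': "x + s *\<^sub>R w + t *\<^sub>R u \<in> S" if "0 \<le> s" "s \<le> h" "0 \<le> t" "t \<le> h" for s t
    using d(2)[OF near[of t s]] that by (simp add: algebra_simps)
  obtain s' t' where 2: "0 < s'" "s' < h" "0 < t'" "t' < h"
    "f (x + h *\<^sub>R w + h *\<^sub>R u) - f (x + h *\<^sub>R w) - f (x + h *\<^sub>R u) + f x = h * h * ?Q (x + s' *\<^sub>R w + t' *\<^sub>R u)"
    using second_difference_mean_value[OF f h(1), of x w u] near' by blast
  have "h * h * ?P (x + s *\<^sub>R u + t *\<^sub>R w) = h * h * ?Q (x + t' *\<^sub>R u + s' *\<^sub>R w)"
    using 1(5) 2(5) by (simp add: algebra_simps)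
  then have "?P (x + s *\<^sub>R u + t *\<^sub>R w) = ?Q (x + t' *\<^sub>R u + s' *\<^sub>R w)" using h(1) by simp
  moreover have "dist (?P (x + s *\<^sub>R u + t *\<^sub>R w)) (?P x) < e" using d(2)[OF near[of s t]] 1 by simp
  moreover have "dist (?Q (x + t' *\<^sub>R u + s' *\<^sub>R w)) (?Q x) < e" using d(2)[OF near[of t' s']] 2 by simp
  ultimately have "\<bar>?P x - ?Q x\<bar> < 2 * e" by (simp add: dist_real_def)
  then show False by (simp add: e_def)
qed

section \<open>Smooth maps between manifolds\<close>

text \<open>
  The part of \<^const>\<open>smooth_manifold\<close> on which calculus in charts relies. It passes to products by a
  computation in charts.
\<close>

definition smooth_atlas :: "('a, 'e::real_inner) chart set \<Rightarrow> bool" where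
  "smooth_atlas A \<longleftrightarrow>
     (\<exists>B::'e set. finite B \<and> span B = UNIV) \<and>
     (\<forall>(U, \<phi>)\<in>A. inj_on \<phi> U \<and> open (\<phi> ` U)) \<and>
     (\<forall>(U, \<phi>)\<in>A. \<forall>(V, \<psi>)\<in>A.
        open (\<phi> ` (U \<inter> V)) \<and> smooth_on (\<phi> ` (U \<inter> V)) (\<psi> \<circ> inv_into U \<phi>))"

lemma smooth_manifold_imp_smooth_atlas: "smooth_manifold A \<Longrightarrow> smooth_atlas A"
  by (simp add: smooth_manifold_def smooth_atlas_def)

lemma smooth_atlasD:
  assumes "smooth_atlas A" "(U, \<phi>) \<in> A"
  shows "inj_on \<phi> U" "open (\<phi> ` U)"
    "(V, \<psi>) \<in> A \<Longrightarrow> open (\<phi> ` (U \<inter> V))"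
    "(V, \<psi>) \<in> A \<Longrightarrow> smooth_on (\<phi> ` (U \<inter> V)) (\<psi> \<circ> inv_into U \<phi>)"
  using assms unfolding smooth_atlas_def by blast+

lemma smooth_on_compose_atlas:
  fixes A :: "('a, 'f::real_inner) chart set" and f :: "'e::real_normed_vector \<Rightarrow> 'f"
  assumes "smooth_atlas A" "open S" "f ` S \<subseteq> T" "smooth_on S f" "smooth_on T g"
  shows "smooth_on S (\<lambda>x. g (f x))"
  using assms smooth_on_compose[of _ S f T g] unfolding smooth_atlas_def by blast

lemma pointsE:
  assumes "p \<in> points A"
  obtains U \<phi> where "(U, \<phi>) \<in> A" "p \<in> U"
  using assms by (auto simp: points_def)

lemma pointsI: "(U, \<phi>) \<in> A \<Longrightarrow> p \<in> U \<Longrightarrow> p \<in> points A"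
  by (force simp: points_def)

lemma smooth_mapI:
  assumes "\<And>p. p \<in> points A \<Longrightarrow> f p \<in> points B"
    and "\<And>U \<phi> V \<psi>. (U, \<phi>) \<in> A \<Longrightarrow> (V, \<psi>) \<in> B \<Longrightarrow>
      open (\<phi> ` (U \<inter> f -` V)) \<and> smooth_on (\<phi> ` (U \<inter> f -` V)) (\<psi> \<circ> f \<circ> inv_into U \<phi>)"
  shows "smooth_map A B f"
  using assms unfolding smooth_map_def by blast

lemma smooth_mapD:
  assumes "smooth_map A B f"
  shows "p \<in> points A \<Longrightarrow> f p \<in> points B"
    and "(U, \<phi>) \<in> A \<Longrightarrow> (V, \<psi>) \<in> B \<Longrightarrow> open (\<phi> ` (U \<inter> f -` V))"
    and "(U, \<phi>) \<in> A \<Longrightarrow> (V, \<psi>) \<in> B \<Longrightarrow> smooth_on (\<phi> ` (U \<inter> f -` V)) (\<psi> \<circ> f \<circ> inv_into U \<phi>)"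
  using assms unfolding smooth_map_def by blast+

lemma open_smooth_onI:
  assumes "\<And>y. y \<in> S \<Longrightarrow> \<exists>T. open T \<and> y \<in> T \<and> T \<subseteq> S \<and> smooth_on T f"
  shows "open S \<and> smooth_on S f"
proof
  show "open S" using assms open_subopen[of S] by blast
  show "smooth_on S f" by (rule smooth_on_local) (use assms in blast)
qed

text \<open>
  \<^const>\<open>smooth_map\<close> prescribes the charts at both ends, so a chart in the middle is available only locally:
  around each point the coordinate expression factors through a chart at the intermediate value.
\<close>

lemma smooth_map_compose:
  assumes A: "smooth_atlas A" and B: "smooth_atlas B"
    and f: "smooth_map A B f" and g: "smooth_map B C g"
  shows "smooth_map A C (\<lambda>x. g (f x))"
proof (rule smooth_mapI)
  show "g (f p) \<in> points C" if "p \<in> points A" for p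
    by (rule smooth_mapD(1)[OF g smooth_mapD(1)[OF f that]])
next
  fix U \<phi> W \<kappa> assume U: "(U, \<phi>) \<in> A" and W: "(W, \<kappa>) \<in> C"
  have inj: "inj_on \<phi> U" by (rule smooth_atlasD(1)[OF A U])
  let ?S = "\<phi> ` (U \<inter> (\<lambda>x. g (f x)) -` W)" and ?e = "\<kappa> \<circ> (\<lambda>x. g (f x)) \<circ> inv_into U \<phi>"
  show "open ?S \<and> smooth_on ?S ?e"
  proof (rule open_smooth_onI)
    fix y assume "y \<in> ?S"
    then obtain x where x: "y = \<phi> x" "x \<in> U" "g (f x) \<in> W" by blast
    have "f x \<in> points B" by (rule smooth_mapD(1)[OF f pointsI[OF U x(2)]])
    then obtain V \<psi> where V: "(V, \<psi>) \<in> B" "f x \<in> V" by (rule pointsE)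
    have injV: "inj_on \<psi> V" by (rule smooth_atlasD(1)[OF B V(1)])
    let ?P = "\<phi> ` (U \<inter> f -` V)" and ?h = "\<psi> \<circ> f \<circ> inv_into U \<phi>"
    let ?Q = "\<psi> ` (V \<inter> g -` W)" and ?k = "\<kappa> \<circ> g \<circ> inv_into V \<psi>"
    let ?T = "?P \<inter> ?h -` ?Q"
    have h: "smooth_on ?P ?h" and P: "open ?P" by (rule smooth_mapD(2,3)[OF f U V(1)])+
    have k: "smooth_on ?Q ?k" and Q: "open ?Q" by (rule smooth_mapD(2,3)[OF g V(1) W])+
    have T: "open ?T" by (rule continuous_open_preimage[OF smooth_on_continuous[OF h] P Q])
    have T_iff: "\<exists>x'\<in>U. y' = \<phi> x' \<and> f x' \<in> V \<and> g (f x') \<in> W" if "y' \<in> ?T" for y'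
    proof -
      from that obtain x' where x': "x' \<in> U" "f x' \<in> V" "y' = \<phi> x'" by blast
      with that inj have "\<psi> (f x') \<in> ?Q" by auto
      with injV x'(2) have "g (f x') \<in> W" by (auto simp: inj_on_def)
      with x' show ?thesis by blast
    qed
    have "smooth_on ?T (\<lambda>y. ?k (?h y))"
      by (rule smooth_on_compose_atlas[OF B T _ smooth_on_subset[OF h] k]) auto
    then have "smooth_on ?T ?e"
    proof (rule smooth_on_cong_imp[OF T, rotated])
      fix y' assume "y' \<in> ?T"
      from T_iff[OF this] show "?k (?h y') = ?e y'" using inj injV by auto
    qed
    moreover have "y \<in> ?T" using x V inj by auto
    moreover have "?T \<subseteq> ?S"
    proof
      fix y' assume "y' \<in> ?T"
      from T_iff[OF this] show "y' \<in> ?S" by auto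
    qed
    ultimately show "\<exists>T. open T \<and> y \<in> T \<and> T \<subseteq> ?S \<and> smooth_on T ?e" using T by blast
  qed
qed

lemma smooth_map_cong:
  assumes A: "smooth_atlas A" and eq: "\<And>p. p \<in> points A \<Longrightarrow> f p = g p" and f: "smooth_map A B f"
  shows "smooth_map A B g"
proof (rule smooth_mapI)
  show "g p \<in> points B" if "p \<in> points A" for p
    using smooth_mapD(1)[OF f that] eq[OF that] by simp
next
  fix U \<phi> V \<psi> assume U: "(U, \<phi>) \<in> A" and V: "(V, \<psi>) \<in> B"
  have e: "f p = g p" if "p \<in> U" for p using eq pointsI[OF U that] by simp
  then have eqS: "U \<inter> f -` V = U \<inter> g -` V" by auto
  have o: "open (\<phi> ` (U \<inter> g -` V))" using smooth_mapD(2)[OF f U V] by (simp add: eqS)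
  moreover have "smooth_on (\<phi> ` (U \<inter> g -` V)) (\<psi> \<circ> g \<circ> inv_into U \<phi>)"
    by (rule smooth_on_cong_imp[OF o _ smooth_mapD(3)[OF f U V, unfolded eqS]])
      (auto simp: e inv_into_into)
  ultimately show "open (\<phi> ` (U \<inter> g -` V)) \<and> smooth_on (\<phi> ` (U \<inter> g -` V)) (\<psi> \<circ> g \<circ> inv_into U \<phi>)" ..
qed

lemma smooth_map_ident: "smooth_atlas A \<Longrightarrow> smooth_map A A (\<lambda>x. x)"
  by (rule smooth_mapI) (use smooth_atlasD(3,4) in \<open>auto simp: vimage_def o_def\<close>)

lemma smooth_map_const:
  assumes "smooth_atlas A" "c \<in> points B"
  shows "smooth_map A B (\<lambda>x. c)"
proof (rule smooth_mapI)
  fix U \<phi> V \<psi> assume U: "(U, \<phi>) \<in> A" and V: "(V, \<psi>) \<in> B"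
  have "(\<lambda>x. c) -` V = (if c \<in> V then UNIV else {})" by auto
  then have "open (\<phi> ` (U \<inter> (\<lambda>x. c) -` V))" using smooth_atlasD(2)[OF assms(1) U] by auto
  then show "open (\<phi> ` (U \<inter> (\<lambda>x. c) -` V)) \<and>
      smooth_on (\<phi> ` (U \<inter> (\<lambda>x. c) -` V)) (\<psi> \<circ> (\<lambda>x. c) \<circ> inv_into U \<phi>)"
    using smooth_on_const by (simp add: o_def del: vimage_const)
qed (rule assms)

lemma prod_atlasI: "(U, \<phi>) \<in> A \<Longrightarrow> (V, \<psi>) \<in> B \<Longrightarrow> (U \<times> V, map_prod \<phi> \<psi>) \<in> prod_atlas A B"
  by (force simp: prod_atlas_def)

lemma prod_atlasE:
  assumes "(W, \<kappa>) \<in> prod_atlas A B"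
  obtains U \<phi> V \<psi> where "(U, \<phi>) \<in> A" "(V, \<psi>) \<in> B" "W = U \<times> V" "\<kappa> = map_prod \<phi> \<psi>"
  using assms by (auto simp: prod_atlas_def)

lemma points_prod_atlas: "points (prod_atlas A B) = points A \<times> points B"
  unfolding points_def prod_atlas_def by (auto split: prod.splits)

lemma map_prod_image: "map_prod f g ` (S \<times> T) = (f ` S) \<times> (g ` T)"
  by force

lemma inv_into_map_prod:
  assumes "inj_on \<phi> U" "inj_on \<psi> V" "a \<in> \<phi> ` U" "b \<in> \<psi> ` V"
  shows "inv_into (U \<times> V) (map_prod \<phi> \<psi>) (a, b) = (inv_into U \<phi> a, inv_into V \<psi> b)"
proof (rule inv_into_f_eq)
  show "inj_on (map_prod \<phi> \<psi>) (U \<times> V)" by (rule map_prod_inj_on[OF assms(1,2)])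
qed (use assms in \<open>auto simp: inv_into_into f_inv_into_f\<close>)

lemma finite_dim_prod:
  fixes B :: "'e::real_vector set" and C :: "'f::real_vector set"
  assumes "finite B" "span B = UNIV" "finite C" "span C = UNIV"
  shows "\<exists>D :: ('e \<times> 'f) set. finite D \<and> span D = UNIV"
proof (intro exI conjI)
  let ?f = "\<lambda>x. (x, 0) :: 'e \<times> 'f" and ?g = "\<lambda>y. (0, y) :: 'e \<times> 'f"
  let ?D = "?f ` B \<union> ?g ` C"
  show "finite ?D" using assms by simp
  have f: "linear ?f" and g: "linear ?g" by (auto intro!: linearI)
  have "(x, y) \<in> span ?D" for x y
  proof -
    have "?f x \<in> span (?f ` B)" "?g y \<in> span (?g ` C)"
      using assms by (simp_all add: linear_span_image f g)
    then have "?f x + ?g y \<in> span ?D"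
      by (intro span_add) (meson Un_upper1 Un_upper2 span_mono subsetD)+
    then show ?thesis by simp
  qed
  then show "span ?D = UNIV" by auto
qed

lemma smooth_on_prodI:
  fixes A :: "('a, 'e::real_inner) chart set" and B :: "('b, 'f::real_inner) chart set"
  assumes A: "smooth_atlas A" and B: "smooth_atlas B" and S: "open (S :: 'e set)" "open (T :: 'f set)"
    and f: "smooth_on S f" and g: "smooth_on T g"
  shows "smooth_on (S \<times> T) (\<lambda>z. (f (fst z), g (snd z)))"
proof -
  have ST: "open (S \<times> T)" by (rule open_Times[OF S])
  show ?thesis
    by (rule smooth_on_Pair[OF ST smooth_on_compose_atlas[OF A ST _ smooth_on_linear[OF ST bounded_linear_fst] f]
          smooth_on_compose_atlas[OF B ST _ smooth_on_linear[OF ST bounded_linear_snd] g]]) auto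
qed

lemma smooth_atlas_prod:
  fixes A :: "('a, 'e::real_inner) chart set" and B :: "('b, 'f::real_inner) chart set"
  assumes A: "smooth_atlas A" and B: "smooth_atlas B"
  shows "smooth_atlas (prod_atlas A B)"
proof -
  have 1: "inj_on \<kappa> W \<and> open (\<kappa> ` W)" if "(W, \<kappa>) \<in> prod_atlas A B" for W \<kappa>
  proof -
    from that obtain U \<phi> V \<psi> where c: "(U, \<phi>) \<in> A" "(V, \<psi>) \<in> B" "W = U \<times> V" "\<kappa> = map_prod \<phi> \<psi>"
      by (rule prod_atlasE)
    show ?thesis unfolding c(3,4) map_prod_image
      by (intro conjI map_prod_inj_on open_Times smooth_atlasD[OF A c(1)] smooth_atlasD[OF B c(2)])
  qed
  have 2: "open (\<kappa> ` (W \<inter> W')) \<and> smooth_on (\<kappa> ` (W \<inter> W')) (\<kappa>' \<circ> inv_into W \<kappa>)"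
    if W: "(W, \<kappa>) \<in> prod_atlas A B" and W': "(W', \<kappa>') \<in> prod_atlas A B" for W \<kappa> W' \<kappa>'
  proof -
    from W obtain U \<phi> V \<psi> where c: "(U, \<phi>) \<in> A" "(V, \<psi>) \<in> B" "W = U \<times> V" "\<kappa> = map_prod \<phi> \<psi>"
      by (rule prod_atlasE)
    from W' obtain U' \<phi>' V' \<psi>' where c': "(U', \<phi>') \<in> A" "(V', \<psi>') \<in> B" "W' = U' \<times> V'" "\<kappa>' = map_prod \<phi>' \<psi>'"
      by (rule prod_atlasE)
    note a = smooth_atlasD[OF A c(1)] smooth_atlasD(3,4)[OF A c(1) c'(1)]
    note b = smooth_atlasD[OF B c(2)] smooth_atlasD(3,4)[OF B c(2) c'(2)]
    have im: "\<kappa> ` (W \<inter> W') = \<phi> ` (U \<inter> U') \<times> \<psi> ` (V \<inter> V')"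
      by (simp add: c c' Times_Int_Times map_prod_image)
    have o: "open (\<kappa> ` (W \<inter> W'))" unfolding im by (intro open_Times a b)
    moreover have "smooth_on (\<kappa> ` (W \<inter> W')) (\<kappa>' \<circ> inv_into W \<kappa>)"
    proof (rule smooth_on_cong_imp[OF o])
      show "smooth_on (\<kappa> ` (W \<inter> W')) (\<lambda>z. ((\<phi>' \<circ> inv_into U \<phi>) (fst z), (\<psi>' \<circ> inv_into V \<psi>) (snd z)))"
        unfolding im by (rule smooth_on_prodI[OF A B a(5) b(5) a(6) b(6)])
      show "((\<phi>' \<circ> inv_into U \<phi>) (fst z), (\<psi>' \<circ> inv_into V \<psi>) (snd z)) = (\<kappa>' \<circ> inv_into W \<kappa>) z"
        if "z \<in> \<kappa> ` (W \<inter> W')" for z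
        using that inv_into_map_prod[OF a(1) b(1), of "fst z" "snd z"] unfolding im
        by (auto simp: c c')
    qed
    ultimately show ?thesis ..
  qed
  have 3: "\<exists>D :: ('e \<times> 'f) set. finite D \<and> span D = UNIV"
    using A B finite_dim_prod unfolding smooth_atlas_def by meson
  show ?thesis unfolding smooth_atlas_def using 1 2 3 by blast
qed

lemma smooth_map_Pair:
  assumes A: "smooth_atlas A" and f: "smooth_map A B f" and g: "smooth_map A C g"
  shows "smooth_map A (prod_atlas B C) (\<lambda>x. (f x, g x))"
proof (rule smooth_mapI)
  show "(f p, g p) \<in> points (prod_atlas B C)" if "p \<in> points A" for p
    using smooth_mapD(1)[OF f that] smooth_mapD(1)[OF g that] by (simp add: points_prod_atlas)
next
  fix U \<phi> W \<kappa> assume U: "(U, \<phi>) \<in> A" and W: "(W, \<kappa>) \<in> prod_atlas B C"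
  from W obtain V \<psi> V' \<psi>' where c: "(V, \<psi>) \<in> B" "(V', \<psi>') \<in> C" "W = V \<times> V'" "\<kappa> = map_prod \<psi> \<psi>'"
    by (rule prod_atlasE)
  let ?S = "\<phi> ` (U \<inter> (\<lambda>x. (f x, g x)) -` W)"
  have S: "?S = \<phi> ` (U \<inter> f -` V) \<inter> \<phi> ` (U \<inter> g -` V')"
    using smooth_atlasD(1)[OF A U] by (auto simp: c inj_on_def)
  have o: "open ?S" unfolding S by (intro open_Int smooth_mapD(2)[OF f U c(1)] smooth_mapD(2)[OF g U c(2)])
  have "smooth_on ?S (\<lambda>x. ((\<psi> \<circ> f \<circ> inv_into U \<phi>) x, (\<psi>' \<circ> g \<circ> inv_into U \<phi>) x))"
    by (intro smooth_on_Pair[OF o] smooth_on_subset[OF smooth_mapD(3)[OF f U c(1)]]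
        smooth_on_subset[OF smooth_mapD(3)[OF g U c(2)]]) (auto simp: S)
  with o show "open ?S \<and> smooth_on ?S (\<kappa> \<circ> (\<lambda>x. (f x, g x)) \<circ> inv_into U \<phi>)"
    by (simp add: c o_def)
qed

lemma smooth_map_fst:
  assumes A: "smooth_atlas A" and B: "smooth_atlas B"
  shows "smooth_map (prod_atlas A B) A fst"
proof (rule smooth_mapI)
  show "fst p \<in> points A" if "p \<in> points (prod_atlas A B)" for p
    using that by (auto simp: points_prod_atlas)
next
  fix W \<kappa> U' \<phi>' assume W: "(W, \<kappa>) \<in> prod_atlas A B" and U': "(U', \<phi>') \<in> A"
  from W obtain U \<phi> V \<psi> where c: "(U, \<phi>) \<in> A" "(V, \<psi>) \<in> B" "W = U \<times> V" "\<kappa> = map_prod \<phi> \<psi>"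
    by (rule prod_atlasE)
  note a = smooth_atlasD[OF A c(1)] smooth_atlasD(3,4)[OF A c(1) U'] and b = smooth_atlasD[OF B c(2)]
  let ?S = "\<kappa> ` (W \<inter> fst -` U')"
  have "W \<inter> fst -` U' = (U \<inter> U') \<times> V" by (auto simp: c)
  then have im: "?S = \<phi> ` (U \<inter> U') \<times> \<psi> ` V" by (simp add: c map_prod_image)
  have o: "open ?S" unfolding im by (intro open_Times a b)
  have "smooth_on ?S (\<lambda>z. (\<phi>' \<circ> inv_into U \<phi>) (fst z))"
    by (rule smooth_on_compose_atlas[OF A o _ smooth_on_linear[OF o bounded_linear_fst] a(6)]) (auto simp: im)
  then have "smooth_on ?S (\<phi>' \<circ> fst \<circ> inv_into W \<kappa>)"
  proof (rule smooth_on_cong_imp[OF o, rotated])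
    show "(\<phi>' \<circ> inv_into U \<phi>) (fst z) = (\<phi>' \<circ> fst \<circ> inv_into W \<kappa>) z" if "z \<in> ?S" for z
      using that inv_into_map_prod[OF a(1) b(1), of "fst z" "snd z"] unfolding im by (auto simp: c)
  qed
  with o show "open ?S \<and> smooth_on ?S (\<phi>' \<circ> fst \<circ> inv_into W \<kappa>)" ..
qed

lemma smooth_map_snd:
  assumes A: "smooth_atlas A" and B: "smooth_atlas B"
  shows "smooth_map (prod_atlas A B) B snd"
proof (rule smooth_mapI)
  show "snd p \<in> points B" if "p \<in> points (prod_atlas A B)" for p
    using that by (auto simp: points_prod_atlas)
next
  fix W \<kappa> V' \<psi>' assume W: "(W, \<kappa>) \<in> prod_atlas A B" and V': "(V', \<psi>') \<in> B"
  from W obtain U \<phi> V \<psi> where c: "(U, \<phi>) \<in> A" "(V, \<psi>) \<in> B" "W = U \<times> V" "\<kappa> = map_prod \<phi> \<psi>"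
    by (rule prod_atlasE)
  note a = smooth_atlasD[OF A c(1)] and b = smooth_atlasD[OF B c(2)] smooth_atlasD(3,4)[OF B c(2) V']
  let ?S = "\<kappa> ` (W \<inter> snd -` V')"
  have "W \<inter> snd -` V' = U \<times> (V \<inter> V')" by (auto simp: c)
  then have im: "?S = \<phi> ` U \<times> \<psi> ` (V \<inter> V')" by (simp add: c map_prod_image)
  have o: "open ?S" unfolding im by (intro open_Times a b)
  have "smooth_on ?S (\<lambda>z. (\<psi>' \<circ> inv_into V \<psi>) (snd z))"
    by (rule smooth_on_compose_atlas[OF B o _ smooth_on_linear[OF o bounded_linear_snd] b(6)]) (auto simp: im)
  then have "smooth_on ?S (\<psi>' \<circ> snd \<circ> inv_into W \<kappa>)"
  proof (rule smooth_on_cong_imp[OF o, rotated])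
    show "(\<psi>' \<circ> inv_into V \<psi>) (snd z) = (\<psi>' \<circ> snd \<circ> inv_into W \<kappa>) z" if "z \<in> ?S" for z
      using that inv_into_map_prod[OF a(1) b(1), of "fst z" "snd z"] unfolding im by (auto simp: c)
  qed
  with o show "open ?S \<and> smooth_on ?S (\<psi>' \<circ> snd \<circ> inv_into W \<kappa>)" ..
qed

lemma smooth_functions_iff:
  fixes A :: "('a, 'e::real_inner) chart set"
  assumes "smooth_atlas A"
  shows "f \<in> smooth_functions A \<longleftrightarrow> (\<forall>(U, \<phi>)\<in>A. smooth_on (\<phi> ` U) (f \<circ> inv_into U \<phi>))"
proof -
  have "(\<lambda>x. x) \<circ> f \<circ> g = f \<circ> g" for g :: "'e \<Rightarrow> 'a" by auto
  then show ?thesis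
    using smooth_atlasD(2)[OF assms] by (auto simp: smooth_functions_def smooth_map_def std_atlas_def points_def)
qed

lemma smooth_functionsD:
  "smooth_atlas A \<Longrightarrow> f \<in> smooth_functions A \<Longrightarrow> (U, \<phi>) \<in> A \<Longrightarrow> smooth_on (\<phi> ` U) (f \<circ> inv_into U \<phi>)"
  using smooth_functions_iff by blast

text \<open>
  Smoothness does not see the values outside the manifold. The operations of a group
  are arbitrary there, so identities between them hold on the carrier only.
\<close>

lemma smooth_functions_cong:
  assumes A: "smooth_atlas A" and "\<And>p. p \<in> points A \<Longrightarrow> f p = g p"
  shows "f \<in> smooth_functions A \<longleftrightarrow> g \<in> smooth_functions A"
  unfolding smooth_functions_def mem_Collect_eq
  using smooth_map_cong[OF A, of f g] smooth_map_cong[OF A, of g f] assms(2) by auto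

lemma smooth_functions_compose:
  assumes "smooth_atlas A" "smooth_atlas B" "smooth_map A B F" "f \<in> smooth_functions B"
  shows "(\<lambda>x. f (F x)) \<in> smooth_functions A"
  using smooth_map_compose[OF assms(1-3)] assms(4) by (simp add: smooth_functions_def)

lemma smooth_map_slice:
  assumes "smooth_atlas A" "smooth_atlas B"
  shows "q \<in> points B \<Longrightarrow> smooth_map A (prod_atlas A B) (\<lambda>p. (p, q))"
    and "p \<in> points A \<Longrightarrow> smooth_map B (prod_atlas A B) (\<lambda>q. (p, q))"
  by (intro smooth_map_Pair smooth_map_ident smooth_map_const assms; assumption)+

section \<open>Tangent vectors\<close>

text \<open>
  The tangent vector at \<open>p\<close> whose coordinates in the chart \<open>(U, \<phi>)\<close> are \<open>v\<close>.
\<close>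

definition chart_tangent ::
  "('a, 'e::real_inner) chart set \<Rightarrow> 'a set \<Rightarrow> ('a \<Rightarrow> 'e) \<Rightarrow> 'a \<Rightarrow> 'e \<Rightarrow> 'a tangent" where
  "chart_tangent A U \<phi> p v =
     (\<lambda>f. if f \<in> smooth_functions A then dir_deriv (f \<circ> inv_into U \<phi>) (\<phi> p) v else 0)"

lemma deriv_eq_derivative_1:
  fixes g :: "real \<Rightarrow> real"
  assumes "(g has_derivative g') (at x)"
  shows "deriv g x = g' 1"
proof -
  have "linear g'" by (rule has_derivative_linear[OF assms])
  then have "g' = (*) (g' 1)"
    by (metis ext linear_scale mult.commute mult.right_neutral real_scaleR_def)
  then have "(g has_real_derivative g' 1) (at x)"
    using assms by (simp add: has_field_derivative_def)
  then show ?thesis by (rule DERIV_imp_deriv)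
qed

lemma smooth_functions_has_derivative:
  assumes "smooth_atlas A" "f \<in> smooth_functions A" "(U, \<phi>) \<in> A" "p \<in> U"
  shows "((f \<circ> inv_into U \<phi>) has_derivative dir_deriv (f \<circ> inv_into U \<phi>) (\<phi> p)) (at (\<phi> p))"
  using smooth_on_has_derivative[OF smooth_functionsD[OF assms(1-3)]] assms(4) by blast

lemma tangent_space_subset_chart:
  assumes A: "smooth_atlas A" and U: "(U, \<phi>) \<in> A" and p: "p \<in> U" and X: "X \<in> tangent_space A p"
  shows "X \<in> range (chart_tangent A U \<phi> p)"
proof -
  from X obtain \<gamma> \<epsilon> where X: "X = velocity A \<gamma>" and \<epsilon>: "\<epsilon> > 0"
    and \<gamma>: "smooth_map (std_atlas {-\<epsilon><..<\<epsilon>}) A \<gamma>" "\<gamma> 0 = p"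
    unfolding tangent_space_def by blast
  let ?I = "{-\<epsilon><..<\<epsilon>}" and ?c = "\<phi> \<circ> \<gamma>"
  let ?S = "?I \<inter> \<gamma> -` U"
  have I: "(?I, \<lambda>x. x) \<in> std_atlas ?I" by (simp add: std_atlas_def)
  have o: "open ?S" using smooth_mapD(2)[OF \<gamma>(1) I U] by simp
  have "smooth_on ?S (\<phi> \<circ> \<gamma> \<circ> inv_into ?I (\<lambda>x. x))" using smooth_mapD(3)[OF \<gamma>(1) I U] by simp
  then have "smooth_on ?S ?c"
  proof (rule smooth_on_cong_imp[OF o, rotated])
    fix t assume "t \<in> ?S"
    then show "(\<phi> \<circ> \<gamma> \<circ> inv_into ?I (\<lambda>x. x)) t = ?c t"
      using inv_into_f_f[of "\<lambda>x. x" ?I t] by (simp add: inj_on_def)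
  qed
  moreover have 0: "0 \<in> ?S" using \<epsilon> \<gamma>(2) p by simp
  ultimately have c: "(?c has_derivative dir_deriv ?c 0) (at 0)" by (rule smooth_on_has_derivative)
  have "X f = chart_tangent A U \<phi> p (dir_deriv ?c 0 1) f" for f
  proof (cases "f \<in> smooth_functions A")
    case True
    have c0: "?c 0 = \<phi> p" using \<gamma>(2) by simp
    have "((\<lambda>t. (f \<circ> inv_into U \<phi>) (?c t)) has_derivative
        (\<lambda>s. dir_deriv (f \<circ> inv_into U \<phi>) (\<phi> p) (dir_deriv ?c 0 s))) (at 0)"
      by (rule has_derivative_compose[OF c, unfolded c0, OF smooth_functions_has_derivative[OF A True U p]])
    then have "((\<lambda>t. f (\<gamma> t)) has_derivative
        (\<lambda>s. dir_deriv (f \<circ> inv_into U \<phi>) (\<phi> p) (dir_deriv ?c 0 s))) (at 0)"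
      by (rule has_derivative_transform_within_open[OF _ o 0])
        (use smooth_atlasD(1)[OF A U] in auto)
    from deriv_eq_derivative_1[OF this] True show ?thesis
      by (simp add: X velocity_def chart_tangent_def)
  qed (simp add: X velocity_def chart_tangent_def)
  then show ?thesis by (auto simp: fun_eq_iff)
qed

text \<open>
  The velocity is realised by the curve that is a straight line in the chart.
\<close>

lemma chart_tangent_in_tangent_space:
  assumes A: "smooth_atlas A" and U: "(U, \<phi>) \<in> A" and p: "p \<in> U"
  shows "chart_tangent A U \<phi> p v \<in> tangent_space A p"
proof -
  note a = smooth_atlasD[OF A U]
  define c where "c t = \<phi> p + t *\<^sub>R v" for t :: real
  define \<gamma> where "\<gamma> t = inv_into U \<phi> (c t)" for t
  have opc: "open (c -` T)" if "open T" for T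
    using that unfolding c_def by (intro open_vimage) (auto intro!: continuous_intros)
  have "0 \<in> c -` (\<phi> ` U)" using p by (simp add: c_def)
  with opc[OF a(2)] obtain \<epsilon> where \<epsilon>: "\<epsilon> > 0" "ball 0 \<epsilon> \<subseteq> c -` (\<phi> ` U)"
    by (meson open_contains_ball)
  let ?I = "{-\<epsilon><..<\<epsilon>}"
  have cI: "c t \<in> \<phi> ` U" if "t \<in> ?I" for t
  proof -
    have "t \<in> ball 0 \<epsilon>" using that by (auto simp: dist_real_def)
    with \<epsilon>(2) show ?thesis by blast
  qed
  have \<gamma>U: "\<gamma> t \<in> U" and \<phi>\<gamma>: "\<phi> (\<gamma> t) = c t" if "t \<in> ?I" for t
    using cI[OF that] by (simp_all add: \<gamma>_def inv_into_into f_inv_into_f)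
  have \<gamma>0: "\<gamma> 0 = p" using a(1) p by (simp add: \<gamma>_def c_def)
  have sm: "smooth_map (std_atlas ?I) A \<gamma>"
  proof (rule smooth_mapI)
    show "\<gamma> t \<in> points A" if "t \<in> points (std_atlas ?I)" for t
      using that by (intro pointsI[OF U] \<gamma>U) (auto simp: points_def std_atlas_def)
  next
    fix J \<iota> V \<psi> assume J: "(J, \<iota>) \<in> std_atlas ?I" and V: "(V, \<psi>) \<in> A"
    then have J: "J = ?I" "\<iota> = (\<lambda>x. x)" by (auto simp: std_atlas_def)
    let ?T = "\<phi> ` (U \<inter> V)"
    have "\<gamma> t \<in> V \<longleftrightarrow> c t \<in> ?T" if "t \<in> ?I" for t
      using inj_on_image_mem_iff[OF a(1) \<gamma>U[OF that], of "U \<inter> V"] \<gamma>U[OF that] \<phi>\<gamma>[OF that] by simp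
    then have eq: "?I \<inter> \<gamma> -` V = ?I \<inter> c -` ?T" by blast
    have o: "open (?I \<inter> \<gamma> -` V)" unfolding eq by (intro open_Int opc a(3)[OF V]) simp
    have "smooth_on (?I \<inter> \<gamma> -` V) c"
      unfolding c_def using smooth_on_affine[OF o bounded_linear_scaleR_left] .
    from smooth_on_compose_atlas[OF A o _ this a(4)[OF V]]
    have "smooth_on (?I \<inter> \<gamma> -` V) (\<lambda>t. (\<psi> \<circ> inv_into U \<phi>) (c t))"
      by (auto simp: eq)
    then have "smooth_on (?I \<inter> \<gamma> -` V) (\<psi> \<circ> \<gamma> \<circ> inv_into ?I (\<lambda>x. x))"
    proof (rule smooth_on_cong_imp[OF o, rotated])
      fix t assume "t \<in> ?I \<inter> \<gamma> -` V"
      then show "(\<psi> \<circ> inv_into U \<phi>) (c t) = (\<psi> \<circ> \<gamma> \<circ> inv_into ?I (\<lambda>x. x)) t"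
        using inv_into_f_f[of "\<lambda>x. x" ?I t] by (simp add: inj_on_def \<gamma>_def)
    qed
    then show "open (\<iota> ` (J \<inter> \<gamma> -` V)) \<and> smooth_on (\<iota> ` (J \<inter> \<gamma> -` V)) (\<psi> \<circ> \<gamma> \<circ> inv_into J \<iota>)"
      using o by (simp add: J)
  qed
  have "velocity A \<gamma> f = chart_tangent A U \<phi> p v f" for f
  proof (cases "f \<in> smooth_functions A")
    case True
    have c: "(c has_derivative (\<lambda>s. s *\<^sub>R v)) (at 0)"
      unfolding c_def by (auto intro!: derivative_eq_intros)
    have c0: "c 0 = \<phi> p" by (simp add: c_def)
    have "((\<lambda>t. (f \<circ> inv_into U \<phi>) (c t)) has_derivative
        (\<lambda>s. dir_deriv (f \<circ> inv_into U \<phi>) (\<phi> p) (s *\<^sub>R v))) (at 0)"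
      by (rule has_derivative_compose[OF c, unfolded c0, OF smooth_functions_has_derivative[OF A True U p]])
    from deriv_eq_derivative_1[OF this] True show ?thesis
      by (simp add: velocity_def chart_tangent_def \<gamma>_def o_def)
  qed (simp add: velocity_def chart_tangent_def)
  then have "chart_tangent A U \<phi> p v = velocity A \<gamma>" by (simp add: fun_eq_iff)
  with \<epsilon>(1) sm \<gamma>0 show ?thesis unfolding tangent_space_def by blast
qed

text \<open>
  This replaces curves by vectors of the model space: linear structure, product decomposition and
  closure under brackets of the tangent spaces are all read off from coordinates.
\<close>

lemma tangent_space_chart:
  assumes "smooth_atlas A" "(U, \<phi>) \<in> A" "p \<in> U"
  shows "tangent_space A p = range (chart_tangent A U \<phi> p)"
  using tangent_space_subset_chart[OF assms] chart_tangent_in_tangent_space[OF assms] by blast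

lemma tangent_space_chartE:
  assumes "smooth_atlas A" "(U, \<phi>) \<in> A" "p \<in> U" "X \<in> tangent_space A p"
  obtains v where "X = chart_tangent A U \<phi> p v"
  using tangent_space_chart[OF assms(1-3)] assms(4) by blast

lemma chart_tangent_linear:
  assumes "smooth_atlas A" "(U, \<phi>) \<in> A" "p \<in> U"
  shows "linear (\<lambda>v. chart_tangent A U \<phi> p v f)"
proof (cases "f \<in> smooth_functions A")
  case True
  then have "linear (dir_deriv (f \<circ> inv_into U \<phi>) (\<phi> p))"
    using smooth_functions_has_derivative[OF assms(1) True assms(2,3)] has_derivative_linear by blast
  with True show ?thesis by (simp add: chart_tangent_def)
qed (simp add: chart_tangent_def linear_zero)

lemma tangent_space_add:
  assumes A: "smooth_atlas A" and p: "p \<in> points A"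
    and X: "X \<in> tangent_space A p" and Y: "Y \<in> tangent_space A p"
  shows "(\<lambda>f. X f + Y f) \<in> tangent_space A p"
proof -
  obtain U \<phi> where U: "(U, \<phi>) \<in> A" "p \<in> U" using p by (rule pointsE)
  obtain v where v: "X = chart_tangent A U \<phi> p v" by (rule tangent_space_chartE[OF A U X])
  obtain w where w: "Y = chart_tangent A U \<phi> p w" by (rule tangent_space_chartE[OF A U Y])
  have "(\<lambda>f. X f + Y f) = chart_tangent A U \<phi> p (v + w)"
    by (rule ext) (simp add: v w linear_add[OF chart_tangent_linear[OF A U]])
  then show ?thesis using chart_tangent_in_tangent_space[OF A U] by simp
qed

lemma tangent_space_scale:
  assumes A: "smooth_atlas A" and p: "p \<in> points A" and X: "X \<in> tangent_space A p"
  shows "(\<lambda>f. c * X f) \<in> tangent_space A p"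
proof -
  obtain U \<phi> where U: "(U, \<phi>) \<in> A" "p \<in> U" using p by (rule pointsE)
  obtain v where v: "X = chart_tangent A U \<phi> p v" by (rule tangent_space_chartE[OF A U X])
  have "(\<lambda>f. c * X f) = chart_tangent A U \<phi> p (c *\<^sub>R v)"
    by (rule ext) (simp add: v linear_scale[OF chart_tangent_linear[OF A U]])
  then show ?thesis using chart_tangent_in_tangent_space[OF A U] by simp
qed

lemma tangent_space_zero:
  assumes A: "smooth_atlas A" and p: "p \<in> points A"
  shows "(\<lambda>f. 0) \<in> tangent_space A p"
proof -
  obtain U \<phi> where U: "(U, \<phi>) \<in> A" "p \<in> U" using p by (rule pointsE)
  have "(\<lambda>f. 0) = chart_tangent A U \<phi> p 0"
    by (rule ext) (simp add: linear_0[OF chart_tangent_linear[OF A U]])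
  then show ?thesis using chart_tangent_in_tangent_space[OF A U] by simp
qed

lemma tangent_nonsmooth: "X \<in> tangent_space A p \<Longrightarrow> f \<notin> smooth_functions A \<Longrightarrow> X f = 0"
  by (auto simp: tangent_space_def velocity_def)

lemma tangent_cong:
  assumes A: "smooth_atlas A" and p: "p \<in> points A" and X: "X \<in> tangent_space A p"
    and eq: "\<And>q. q \<in> points A \<Longrightarrow> f q = g q"
  shows "X f = X g"
proof -
  obtain U \<phi> where U: "(U, \<phi>) \<in> A" "p \<in> U" using p by (rule pointsE)
  obtain v where v: "X = chart_tangent A U \<phi> p v" by (rule tangent_space_chartE[OF A U X])
  have "dir_deriv (f \<circ> inv_into U \<phi>) (\<phi> p) = dir_deriv (g \<circ> inv_into U \<phi>) (\<phi> p)"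
    by (rule dir_deriv_cong[OF smooth_atlasD(2)[OF A U(1)]])
      (use U in \<open>auto intro!: eq pointsI[OF U(1)] inv_into_into\<close>)
  then show ?thesis
    by (simp add: v chart_tangent_def smooth_functions_cong[OF A eq])
qed

lemma tangent_const:
  assumes A: "smooth_atlas A" and p: "p \<in> points A" and X: "X \<in> tangent_space A p"
  shows "X (\<lambda>q. c) = 0"
proof -
  obtain U \<phi> where U: "(U, \<phi>) \<in> A" "p \<in> U" using p by (rule pointsE)
  obtain v where v: "X = chart_tangent A U \<phi> p v" by (rule tangent_space_chartE[OF A U X])
  show ?thesis by (simp add: v chart_tangent_def o_def)
qed


section \<open>Tangent vectors of a product\<close>

lemma dir_deriv_slice:
  assumes "(K has_derivative dir_deriv K (a, b)) (at (a, b))"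
  shows "dir_deriv (\<lambda>a. K (a, b)) a v = dir_deriv K (a, b) (v, 0)"
    and "dir_deriv (\<lambda>b. K (a, b)) b w = dir_deriv K (a, b) (0, w)"
proof -
  have "((\<lambda>a. (a, b)) has_derivative (\<lambda>v. (v, 0))) (at a)"
    by (intro has_derivative_Pair has_derivative_ident has_derivative_const)
  from dir_derivI[OF has_derivative_compose[OF this assms]]
  show "dir_deriv (\<lambda>a. K (a, b)) a v = dir_deriv K (a, b) (v, 0)" by simp
  have "((\<lambda>b. (a, b)) has_derivative (\<lambda>w. (0, w))) (at b)"
    by (intro has_derivative_Pair has_derivative_ident has_derivative_const)
  from dir_derivI[OF has_derivative_compose[OF this assms]]
  show "dir_deriv (\<lambda>b. K (a, b)) b w = dir_deriv K (a, b) (0, w)" by simp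
qed

context
  fixes A :: "('a, 'e::real_inner) chart set" and B :: "('b, 'f::real_inner) chart set"
    and U :: "'a set" and \<phi> :: "'a \<Rightarrow> 'e" and V :: "'b set" and \<psi> :: "'b \<Rightarrow> 'f"
  assumes A: "smooth_atlas A" and B: "smooth_atlas B"
    and U: "(U, \<phi>) \<in> A" and V: "(V, \<psi>) \<in> B"
begin

abbreviation (input) prod_coord :: "('a \<times> 'b \<Rightarrow> 'c) \<Rightarrow> 'e \<times> 'f \<Rightarrow> 'c" where
  "prod_coord F \<equiv> F \<circ> inv_into (U \<times> V) (map_prod \<phi> \<psi>)"

lemma prod_coord_eq:
  assumes "a \<in> \<phi> ` U" "b \<in> \<psi> ` V"
  shows "prod_coord F (a, b) = F (inv_into U \<phi> a, inv_into V \<psi> b)"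
  using inv_into_map_prod[OF smooth_atlasD(1)[OF A U] smooth_atlasD(1)[OF B V] assms] by simp

lemma smooth_on_prod_coord:
  "F \<in> smooth_functions (prod_atlas A B) \<Longrightarrow> smooth_on (\<phi> ` U \<times> \<psi> ` V) (prod_coord F)"
  using smooth_functionsD[OF smooth_atlas_prod[OF A B] _ prod_atlasI[OF U V]] by (simp add: map_prod_image)

lemma chart_tangent_slice_fst:
  assumes F: "F \<in> smooth_functions (prod_atlas A B)" and p: "p \<in> U" and q: "q \<in> V"
  shows "chart_tangent A U \<phi> p v (\<lambda>p'. F (p', q)) = dir_deriv (prod_coord F) (\<phi> p, \<psi> q) (v, 0)"
proof -
  have "(\<lambda>p'. F (p', q)) \<in> smooth_functions A"
    using smooth_functions_compose[OF A smooth_atlas_prod[OF A B] smooth_map_slice(1)[OF A B pointsI[OF V q]] F] .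
  moreover have "dir_deriv ((\<lambda>p'. F (p', q)) \<circ> inv_into U \<phi>) (\<phi> p) = dir_deriv (\<lambda>a. prod_coord F (a, \<psi> q)) (\<phi> p)"
    by (rule dir_deriv_cong[OF smooth_atlasD(2)[OF A U]])
      (use p q prod_coord_eq[of _ "\<psi> q" F] smooth_atlasD(1)[OF B V] in auto)
  moreover have "(\<phi> p, \<psi> q) \<in> \<phi> ` U \<times> \<psi> ` V" using p q by simp
  ultimately show ?thesis
    using dir_deriv_slice(1)[OF smooth_on_has_derivative[OF smooth_on_prod_coord[OF F]]]
    by (simp add: chart_tangent_def)
qed

lemma chart_tangent_slice_snd:
  assumes F: "F \<in> smooth_functions (prod_atlas A B)" and p: "p \<in> U" and q: "q \<in> V"
  shows "chart_tangent B V \<psi> q w (\<lambda>q'. F (p, q')) = dir_deriv (prod_coord F) (\<phi> p, \<psi> q) (0, w)"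
proof -
  have "(\<lambda>q'. F (p, q')) \<in> smooth_functions B"
    using smooth_functions_compose[OF B smooth_atlas_prod[OF A B] smooth_map_slice(2)[OF A B pointsI[OF U p]] F] .
  moreover have "dir_deriv ((\<lambda>q'. F (p, q')) \<circ> inv_into V \<psi>) (\<psi> q) = dir_deriv (\<lambda>b. prod_coord F (\<phi> p, b)) (\<psi> q)"
    by (rule dir_deriv_cong[OF smooth_atlasD(2)[OF B V]])
      (use p q prod_coord_eq[of "\<phi> p" _ F] smooth_atlasD(1)[OF A U] in auto)
  moreover have "(\<phi> p, \<psi> q) \<in> \<phi> ` U \<times> \<psi> ` V" using p q by simp
  ultimately show ?thesis
    using dir_deriv_slice(2)[OF smooth_on_has_derivative[OF smooth_on_prod_coord[OF F]]]
    by (simp add: chart_tangent_def)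
qed

lemma chart_tangent_prod:
  assumes F: "F \<in> smooth_functions (prod_atlas A B)" and p: "p \<in> U" and q: "q \<in> V"
  shows "chart_tangent (prod_atlas A B) (U \<times> V) (map_prod \<phi> \<psi>) (p, q) (v, w) F =
     chart_tangent A U \<phi> p v (\<lambda>p'. F (p', q)) + chart_tangent B V \<psi> q w (\<lambda>q'. F (p, q'))"
proof -
  have "(\<phi> p, \<psi> q) \<in> \<phi> ` U \<times> \<psi> ` V" using p q by simp
  then have "linear (dir_deriv (prod_coord F) (\<phi> p, \<psi> q))"
    using smooth_on_has_derivative[OF smooth_on_prod_coord[OF F]] has_derivative_linear by blast
  from linear_add[OF this, of "(v, 0)" "(0, w)"] show ?thesis
    using F by (simp add: chart_tangent_slice_fst[OF assms] chart_tangent_slice_snd[OF assms])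
      (simp add: chart_tangent_def)
qed

lemma smooth_on_partial_derivative:
  assumes F: "F \<in> smooth_functions (prod_atlas A B)" and q: "q \<in> V"
  shows "smooth_on (\<phi> ` U) ((\<lambda>p'. chart_tangent B V \<psi> q w (\<lambda>q'. F (p', q'))) \<circ> inv_into U \<phi>)"
proof -
  note AB = smooth_atlas_prod[OF A B]
  have o: "open (\<phi> ` U)" by (rule smooth_atlasD(2)[OF A U])
  have "smooth_on (\<phi> ` U) (\<lambda>a. (a, \<psi> q))"
    by (intro smooth_on_Pair o smooth_on_const smooth_on_linear bounded_linear_ident)
  from smooth_on_compose_atlas[OF AB o _ this smooth_on_dir_deriv[OF smooth_on_prod_coord[OF F]]]
  have "smooth_on (\<phi> ` U) (\<lambda>a. dir_deriv (prod_coord F) (a, \<psi> q) (0, w))"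
    using q by auto
  then show ?thesis
  proof (rule smooth_on_cong_imp[OF o, rotated])
    fix a assume "a \<in> \<phi> ` U"
    then show "dir_deriv (prod_coord F) (a, \<psi> q) (0, w) =
        ((\<lambda>p'. chart_tangent B V \<psi> q w (\<lambda>q'. F (p', q'))) \<circ> inv_into U \<phi>) a"
      using chart_tangent_slice_snd[OF F inv_into_into[of a \<phi> U] q, of w] by (simp add: f_inv_into_f)
  qed
qed

end

text \<open>
  A tangent operator vanishes on non-smooth functions, so an iterated expression \<open>X (\<lambda>p. Y (\<lambda>q. F (p, q)))\<close>
  has its intended meaning only because the inner function is smooth again: in coordinates it is a
  directional derivative of \<open>F\<close> restricted to a slice.
\<close>

lemma smooth_functions_partial_derivative:
  assumes A: "smooth_atlas A" and B: "smooth_atlas B" and q: "q \<in> points B"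
    and F: "F \<in> smooth_functions (prod_atlas A B)" and Y: "Y \<in> tangent_space B q"
  shows "(\<lambda>p. Y (\<lambda>q'. F (p, q'))) \<in> smooth_functions A"
proof -
  obtain V \<psi> where V: "(V, \<psi>) \<in> B" "q \<in> V" using q by (rule pointsE)
  obtain w where Y: "Y = chart_tangent B V \<psi> q w" by (rule tangent_space_chartE[OF B V Y])
  show ?thesis unfolding Y smooth_functions_iff[OF A]
    using smooth_on_partial_derivative[OF A B _ V(1) F V(2)] by blast
qed

text \<open>
  In a product chart, \<open>DF(v, w) = DF(v, 0) + DF(0, w)\<close>. In particular a tangent vector of the product is
  determined by its two projections.
\<close>

lemma tangent_space_prod_split:
  assumes A: "smooth_atlas A" and B: "smooth_atlas B" and p: "p \<in> points A" and q: "q \<in> points B"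
    and X: "X \<in> tangent_space (prod_atlas A B) (p, q)"
  shows "differential A fst X \<in> tangent_space A p"
    and "differential B snd X \<in> tangent_space B q"
    and "F \<in> smooth_functions (prod_atlas A B) \<Longrightarrow>
      X F = differential A fst X (\<lambda>p'. F (p', q)) + differential B snd X (\<lambda>q'. F (p, q'))"
proof -
  obtain U \<phi> where U: "(U, \<phi>) \<in> A" "p \<in> U" using p by (rule pointsE)
  obtain V \<psi> where V: "(V, \<psi>) \<in> B" "q \<in> V" using q by (rule pointsE)
  note AB = smooth_atlas_prod[OF A B]
  have "(p, q) \<in> U \<times> V" using U V by simp
  then obtain x where "X = chart_tangent (prod_atlas A B) (U \<times> V) (map_prod \<phi> \<psi>) (p, q) x"
    using tangent_space_chartE[OF AB prod_atlasI[OF U(1) V(1)] _ X] by blast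
  then obtain v w where X: "X = chart_tangent (prod_atlas A B) (U \<times> V) (map_prod \<phi> \<psi>) (p, q) (v, w)"
    by (cases x) blast
  have const: "chart_tangent A U \<phi> p v (\<lambda>p'. c) = 0" "chart_tangent B V \<psi> q w (\<lambda>q'. c) = 0" for c
    by (simp_all add: chart_tangent_def o_def)
  have 1: "differential A fst X = chart_tangent A U \<phi> p v"
  proof
    fix f
    show "differential A fst X f = chart_tangent A U \<phi> p v f"
    proof (cases "f \<in> smooth_functions A")
      case True
      from smooth_functions_compose[OF AB A smooth_map_fst[OF A B] this] True
      show ?thesis
        using chart_tangent_prod[OF A B U(1) V(1) _ U(2) V(2), of "f \<circ> fst" v w]
        by (simp add: differential_def X const o_def)
    qed (simp add: differential_def chart_tangent_def)
  qed
  have 2: "differential B snd X = chart_tangent B V \<psi> q w"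
  proof
    fix f
    show "differential B snd X f = chart_tangent B V \<psi> q w f"
    proof (cases "f \<in> smooth_functions B")
      case True
      from smooth_functions_compose[OF AB B smooth_map_snd[OF A B] this] True
      show ?thesis
        using chart_tangent_prod[OF A B U(1) V(1) _ U(2) V(2), of "f \<circ> snd" v w]
        by (simp add: differential_def X const o_def)
    qed (simp add: differential_def chart_tangent_def)
  qed
  show "differential A fst X \<in> tangent_space A p" "differential B snd X \<in> tangent_space B q"
    using chart_tangent_in_tangent_space[OF A U] chart_tangent_in_tangent_space[OF B V] by (simp_all add: 1 2)
  show "X F = differential A fst X (\<lambda>p'. F (p', q)) + differential B snd X (\<lambda>q'. F (p, q'))"
    if "F \<in> smooth_functions (prod_atlas A B)"
    unfolding 1 2 unfolding X by (rule chart_tangent_prod[OF A B U(1) V(1) that U(2) V(2)])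
qed

lemma tangent_space_prod_pair:
  assumes A: "smooth_atlas A" and B: "smooth_atlas B" and p: "p \<in> points A" and q: "q \<in> points B"
    and X: "X \<in> tangent_space A p" and Y: "Y \<in> tangent_space B q"
  obtains Z where "Z \<in> tangent_space (prod_atlas A B) (p, q)"
    "differential A fst Z = X" "differential B snd Z = Y"
proof -
  obtain U \<phi> where U: "(U, \<phi>) \<in> A" "p \<in> U" using p by (rule pointsE)
  obtain V \<psi> where V: "(V, \<psi>) \<in> B" "q \<in> V" using q by (rule pointsE)
  obtain v where v: "X = chart_tangent A U \<phi> p v" by (rule tangent_space_chartE[OF A U X])
  obtain w where w: "Y = chart_tangent B V \<psi> q w" by (rule tangent_space_chartE[OF B V Y])
  note AB = smooth_atlas_prod[OF A B]
  define Z where "Z = chart_tangent (prod_atlas A B) (U \<times> V) (map_prod \<phi> \<psi>) (p, q) (v, w)"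
  have Z: "Z \<in> tangent_space (prod_atlas A B) (p, q)" unfolding Z_def
    by (rule chart_tangent_in_tangent_space[OF AB prod_atlasI[OF U(1) V(1)]]) (use U V in simp)
  have const: "X (\<lambda>p'. c) = 0" "Y (\<lambda>q'. c) = 0" for c
    by (simp_all add: v w chart_tangent_def o_def)
  have split: "Z F = X (\<lambda>p'. F (p', q)) + Y (\<lambda>q'. F (p, q'))" if "F \<in> smooth_functions (prod_atlas A B)" for F
    unfolding Z_def v w by (rule chart_tangent_prod[OF A B U(1) V(1) that U(2) V(2)])
  have "differential A fst Z f = X f" for f
  proof (cases "f \<in> smooth_functions A")
    case True
    from split[OF smooth_functions_compose[OF AB A smooth_map_fst[OF A B] this]] True
    show ?thesis by (simp add: differential_def const o_def)
  qed (simp add: differential_def v chart_tangent_def)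
  moreover have "differential B snd Z f = Y f" for f
  proof (cases "f \<in> smooth_functions B")
    case True
    from split[OF smooth_functions_compose[OF AB B smooth_map_snd[OF A B] this]] True
    show ?thesis by (simp add: differential_def const o_def)
  qed (simp add: differential_def w chart_tangent_def)
  ultimately show thesis using that[OF Z] by (simp add: fun_eq_iff)
qed

text \<open>
  The iterated derivative is a first-order operator applied to \<open>f\<close> plus a second derivative of \<open>f\<close> in
  the directions of the two partial derivatives of \<open>F\<close>. Such an expression therefore defines a tangent
  vector as soon as the second-order part is cancelled (in a commutator) or one of the two partial
  derivatives of \<open>F\<close> is zero (for a group action, at the fixed point).
\<close>

lemma mixed_derivative_in_charts:
  fixes A :: "('a, 'e::real_inner) chart set" and B :: "('b, 'f::real_inner) chart set"
    and C :: "('c, 'g::real_inner) chart set"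
  assumes A: "smooth_atlas A" and B: "smooth_atlas B" and C: "smooth_atlas C"
    and U: "(U, \<phi>) \<in> A" "p \<in> U" and V: "(V, \<psi>) \<in> B" "q \<in> V" and W: "(W, \<kappa>) \<in> C" "F (p, q) \<in> W"
    and F: "smooth_map (prod_atlas A B) C F" and f: "f \<in> smooth_functions C"
  defines "H \<equiv> \<kappa> \<circ> F \<circ> inv_into (U \<times> V) (map_prod \<phi> \<psi>)" and "k \<equiv> f \<circ> inv_into W \<kappa>"
    and "c \<equiv> \<kappa> (F (p, q))" and "z\<^sub>0 \<equiv> (\<phi> p, \<psi> q)"
  shows "chart_tangent A U \<phi> p v (\<lambda>p'. chart_tangent B V \<psi> q w (\<lambda>q'. f (F (p', q')))) =
    dir_deriv k c (dir_deriv (\<lambda>z. dir_deriv H z (0, w)) z\<^sub>0 (v, 0)) +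
    dir_deriv (\<lambda>y. dir_deriv k y (dir_deriv H z\<^sub>0 (0, w))) c (dir_deriv H z\<^sub>0 (v, 0))"
proof -
  note AB = smooth_atlas_prod[OF A B]
  note inj = smooth_atlasD(1)[OF A U(1)] smooth_atlasD(1)[OF B V(1)] smooth_atlasD(1)[OF C W(1)]
  let ?N = "map_prod \<phi> \<psi> ` ((U \<times> V) \<inter> F -` W)"
  note N = smooth_mapD(2,3)[OF F prod_atlasI[OF U(1) V(1)] W(1)]
  have zN: "z\<^sub>0 \<in> ?N" using U V W by (force simp: z\<^sub>0_def)
  define G where "G z = f (F z)" for z
  have G: "G \<in> smooth_functions (prod_atlas A B)"
    unfolding G_def by (rule smooth_functions_compose[OF AB C F f])
  define K where "K = G \<circ> inv_into (U \<times> V) (map_prod \<phi> \<psi>)"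
  have K: "smooth_on (\<phi> ` U \<times> \<psi> ` V) K" unfolding K_def by (rule smooth_on_prod_coord[OF A B U(1) V(1) G])
  have z0: "z\<^sub>0 \<in> \<phi> ` U \<times> \<psi> ` V" using U V by (simp add: z\<^sub>0_def)
  let ?P = "\<lambda>p'. chart_tangent B V \<psi> q w (\<lambda>q'. G (p', q'))"
  have P: "?P \<in> smooth_functions A"
    by (rule smooth_functions_partial_derivative[OF A B pointsI[OF V] G chart_tangent_in_tangent_space[OF B V]])
  have "dir_deriv (?P \<circ> inv_into U \<phi>) (\<phi> p) = dir_deriv (\<lambda>a. dir_deriv K (a, \<psi> q) (0, w)) (\<phi> p)"
  proof (rule dir_deriv_cong[OF smooth_atlasD(2)[OF A U(1)]])
    show "(?P \<circ> inv_into U \<phi>) a = dir_deriv K (a, \<psi> q) (0, w)" if "a \<in> \<phi> ` U" for a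
      using that chart_tangent_slice_snd[OF A B U(1) V(1) G inv_into_into[OF that] V(2), of w]
      by (simp add: f_inv_into_f K_def)
  qed (use U in simp)
  then have "chart_tangent A U \<phi> p v ?P = dir_deriv (\<lambda>a. dir_deriv K (a, \<psi> q) (0, w)) (\<phi> p) v"
    using P by (simp add: chart_tangent_def)
  also have "\<dots> = dir_deriv (\<lambda>z. dir_deriv K z (0, w)) z\<^sub>0 (v, 0)"
    using dir_deriv_slice(1)[OF smooth_on_has_derivative[OF smooth_on_dir_deriv[OF K] z0[unfolded z\<^sub>0_def]]]
    by (simp add: z\<^sub>0_def)
  also have "\<dots> = dir_deriv (\<lambda>z. dir_deriv (\<lambda>z. k (H z)) z (0, w)) z\<^sub>0 (v, 0)"
  proof -
    have KH: "K z = k (H z)" if "z \<in> ?N" for z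
      using that inj by (auto simp: K_def H_def k_def G_def inv_into_map_prod[OF inj(1,2)])
    have "dir_deriv K z = dir_deriv (\<lambda>z. k (H z)) z" if "z \<in> ?N" for z
      by (rule dir_deriv_cong[OF N(1) that KH])
    then show ?thesis
      using dir_deriv_cong[OF N(1) zN, of "\<lambda>z. dir_deriv K z (0, w)" "\<lambda>z. dir_deriv (\<lambda>z. k (H z)) z (0, w)"]
      by simp
  qed
  also have "\<dots> = dir_deriv k c (dir_deriv (\<lambda>z. dir_deriv H z (0, w)) z\<^sub>0 (v, 0)) +
    dir_deriv (\<lambda>y. dir_deriv k y (dir_deriv H z\<^sub>0 (0, w))) c (dir_deriv H z\<^sub>0 (v, 0))"
  proof -
    have HN: "H ` ?N \<subseteq> \<kappa> ` W" using inj by (auto simp: H_def inv_into_map_prod[OF inj(1,2)])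
    have Hz0: "H z\<^sub>0 = c" using inv_into_map_prod[OF inj(1,2)] U V inj by (simp add: H_def c_def z\<^sub>0_def)
    obtain Bs where Bs: "finite Bs" "span Bs = (UNIV :: 'g set)"
      using C unfolding smooth_atlas_def by blast
    show ?thesis
      using second_order_chain_rule[OF Bs N(1) HN zN smooth_atlasD(2)[OF C W(1)] N(2)[folded H_def]
          smooth_functionsD[OF C f W(1), folded k_def], of "(0, w)"] 
      unfolding Hz0 .
  qed
  finally show ?thesis by (simp add: G_def)
qed

section \<open>Left-invariant vector fields and their brackets\<close>

text \<open>
  The Lie algebra and its bracket refer to the multiplication and the identity alone. This setting covers
  the two given Lie groups and their semidirect product alike.
\<close>

locale smooth_monoid = monoid G for G :: "('a, 'e::real_inner) lie_struct" (structure) +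
  assumes smooth_atlas: "smooth_atlas (atlas G)"
    and points_atlas: "points (atlas G) = carrier G"
    and smooth_mult: "smooth_map (prod_atlas (atlas G) (atlas G)) (atlas G) (\<lambda>(x, y). x \<otimes> y)"

lemma (in lie_group) smooth_monoid: "smooth_monoid G"
  by (intro smooth_monoid.intro monoid_axioms smooth_monoid_axioms.intro smooth_mult points_atlas
      smooth_manifold_imp_smooth_atlas smooth_manifold_atlas)

lemma differential_apply: "f \<in> smooth_functions B \<Longrightarrow> differential B F X f = X (\<lambda>x. f (F x))"
  by (simp add: differential_def o_def)

context smooth_monoid
begin

lemma one_in_points: "\<one> \<in> points (atlas G)"
  by (simp add: points_atlas)

lemmas lie_algebra_add = tangent_space_add[OF smooth_atlas one_in_points, folded lie_algebra_def]
lemmas lie_algebra_scale = tangent_space_scale[OF smooth_atlas one_in_points, folded lie_algebra_def]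
lemmas lie_algebra_zero = tangent_space_zero[OF smooth_atlas one_in_points, folded lie_algebra_def]
lemmas lie_algebra_cong = tangent_cong[OF smooth_atlas one_in_points, folded lie_algebra_def, unfolded points_atlas]
lemmas lie_algebra_const = tangent_const[OF smooth_atlas one_in_points, folded lie_algebra_def]
lemmas lie_algebra_nonsmooth =
  tangent_nonsmooth[of _ "atlas G" "\<one>", folded lie_algebra_def]

lemma smooth_functions_mult:
  assumes "f \<in> smooth_functions (atlas G)"
  shows "(\<lambda>z. f (fst z \<otimes> snd z)) \<in> smooth_functions (prod_atlas (atlas G) (atlas G))"
  using smooth_functions_compose[OF smooth_atlas_prod[OF smooth_atlas smooth_atlas] smooth_atlas smooth_mult assms]
  by (simp add: case_prod_beta)

text \<open>
  Values of left-invariant fields at \<open>q\<close> are derivatives of left translates, hence of \<open>f\<close> composed with the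
  multiplication; translation by the identity changes nothing on the carrier.
\<close>

lemma lie_bracket_apply:
  assumes X: "X \<in> lie_algebra G" and Y: "Y \<in> lie_algebra G" and f: "f \<in> smooth_functions (atlas G)"
  shows "lie_bracket G X Y f = X (\<lambda>p. Y (\<lambda>q. f (p \<otimes> q))) - Y (\<lambda>p. X (\<lambda>q. f (p \<otimes> q)))"
proof -
  have field: "left_invariant_field G X \<one> (\<lambda>q. left_invariant_field G Y q f) = X (\<lambda>p. Y (\<lambda>q. f (p \<otimes> q)))"
    if X: "X \<in> lie_algebra G" and Y: "Y \<in> lie_algebra G" for X Y
  proof -
    have W: "(\<lambda>q. left_invariant_field G Y q f) = (\<lambda>p. Y (\<lambda>q. f (p \<otimes> q)))"
      using f by (simp add: left_invariant_field_def differential_apply)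
    have "(\<lambda>p. Y (\<lambda>q. f (p \<otimes> q))) \<in> smooth_functions (atlas G)"
      using smooth_functions_partial_derivative[OF smooth_atlas smooth_atlas one_in_points smooth_functions_mult[OF f]
          Y[unfolded lie_algebra_def]] by simp
    then have "left_invariant_field G X \<one> (\<lambda>p. Y (\<lambda>q. f (p \<otimes> q))) = X (\<lambda>p. Y (\<lambda>q. f (\<one> \<otimes> p \<otimes> q)))"
      by (simp add: left_invariant_field_def differential_apply)
    also have "\<dots> = X (\<lambda>p. Y (\<lambda>q. f (p \<otimes> q)))"
      by (rule lie_algebra_cong[OF X]) simp
    finally show ?thesis unfolding W .
  qed
  show ?thesis
    by (simp add: lie_bracket_def vector_field_bracket_def field[OF X Y] field[OF Y X])
qed

lemma lie_bracket_nonsmooth: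
  assumes X: "X \<in> lie_algebra G" and Y: "Y \<in> lie_algebra G" and f: "f \<notin> smooth_functions (atlas G)"
  shows "lie_bracket G X Y f = 0"
proof -
  have "left_invariant_field G Z p f = 0" for Z p
    using f by (simp add: left_invariant_field_def differential_def)
  then show ?thesis
    using lie_algebra_const[OF X] lie_algebra_const[OF Y]
    by (simp add: lie_bracket_def vector_field_bracket_def left_invariant_field_def differential_def o_def)
qed

text \<open>
  Since the identity is neutral, both partial derivatives of the multiplication at the identity are
  the identity map. Hence the second-order parts of \<open>X (Y f)\<close> and \<open>Y (X f)\<close> are second derivatives of \<open>f\<close> in
  the same two directions, and they cancel by symmetry.
\<close>

lemma lie_bracket_in_lie_algebra:
  assumes X: "X \<in> lie_algebra G" and Y: "Y \<in> lie_algebra G"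
  shows "lie_bracket G X Y \<in> lie_algebra G"
proof -
  obtain U \<phi> where U: "(U, \<phi>) \<in> atlas G" "\<one> \<in> U" using one_in_points by (rule pointsE)
  have UG: "U \<subseteq> carrier G" using pointsI[OF U(1)] points_atlas by blast
  note inj = smooth_atlasD(1)[OF smooth_atlas U(1)] and oU = smooth_atlasD(2)[OF smooth_atlas U(1)]
  obtain v where v: "X = chart_tangent (atlas G) U \<phi> \<one> v"
    using tangent_space_chartE[OF smooth_atlas U X[unfolded lie_algebra_def]] .
  obtain w where w: "Y = chart_tangent (atlas G) U \<phi> \<one> w"
    using tangent_space_chartE[OF smooth_atlas U Y[unfolded lie_algebra_def]] .
  let ?m = "\<lambda>(x, y). x \<otimes> y" and ?e = "\<phi> \<one>"
  define H where "H = \<phi> \<circ> ?m \<circ> inv_into (U \<times> U) (map_prod \<phi> \<phi>)"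
  have H: "H (a, b) = \<phi> (inv_into U \<phi> a \<otimes> inv_into U \<phi> b)" if "a \<in> \<phi> ` U" "b \<in> \<phi> ` U" for a b
    using inv_into_map_prod[OF inj inj that] by (simp add: H_def)
  let ?N = "map_prod \<phi> \<phi> ` ((U \<times> U) \<inter> ?m -` U)"
  have "smooth_on ?N H" unfolding H_def
    by (rule smooth_mapD(3)[OF smooth_mult prod_atlasI[OF U(1) U(1)] U(1)])
  moreover have "(?e, ?e) \<in> ?N" using U by force
  ultimately have dH: "(H has_derivative dir_deriv H (?e, ?e)) (at (?e, ?e))"
    by (rule smooth_on_has_derivative)
  have e: "?e \<in> \<phi> ` U" using U by simp
  have "dir_deriv (\<lambda>b. H (?e, b)) ?e = dir_deriv (\<lambda>b. b) ?e"
    by (rule dir_deriv_cong[OF oU e]) (use U UG inj H[OF e] in auto)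
  then have H2: "dir_deriv H (?e, ?e) (0, u) = u" for u
    using dir_deriv_slice(2)[OF dH, symmetric] by simp
  have "dir_deriv (\<lambda>a. H (a, ?e)) ?e = dir_deriv (\<lambda>a. a) ?e"
    by (rule dir_deriv_cong[OF oU e]) (use U UG inj H[OF _ e] in auto)
  then have H1: "dir_deriv H (?e, ?e) (u, 0) = u" for u
    using dir_deriv_slice(1)[OF dH, symmetric] by simp
  \<comment> \<open>The bilinear second-order part of the multiplication at the identity, whose antisymmetrisation
     represents the bracket in coordinates.\<close>
  define z where "z v w = dir_deriv (\<lambda>z. dir_deriv H z (0, w)) (?e, ?e) (v, 0)" for v w
  have "lie_bracket G X Y f = chart_tangent (atlas G) U \<phi> \<one> (z v w - z w v) f" for f
  proof (cases "f \<in> smooth_functions (atlas G)")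
    case True
    let ?k = "f \<circ> inv_into U \<phi>"
    have "chart_tangent (atlas G) U \<phi> \<one> v (\<lambda>p. chart_tangent (atlas G) U \<phi> \<one> w (\<lambda>q. f (p \<otimes> q))) =
        dir_deriv ?k ?e (z v w) + dir_deriv (\<lambda>y. dir_deriv ?k y w) ?e v" for v w
      using mixed_derivative_in_charts[OF smooth_atlas smooth_atlas smooth_atlas U U U(1) _ smooth_mult True, of v w]
        U(2) by (simp add: z_def H_def[symmetric] H1 H2)
    then have "lie_bracket G X Y f =
        dir_deriv ?k ?e (z v w) + dir_deriv (\<lambda>y. dir_deriv ?k y w) ?e v -
        (dir_deriv ?k ?e (z w v) + dir_deriv (\<lambda>y. dir_deriv ?k y v) ?e w)"
      unfolding lie_bracket_apply[OF X Y True] by (simp add: v w)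
    also have "\<dots> = dir_deriv ?k ?e (z v w) - dir_deriv ?k ?e (z w v)"
      using dir_deriv_commute[OF smooth_functionsD[OF smooth_atlas True U(1)] oU e, of v w] by simp
    also have "\<dots> = dir_deriv ?k ?e (z v w - z w v)"
      using has_derivative_linear[OF smooth_functions_has_derivative[OF smooth_atlas True U]]
      by (simp add: linear_diff)
    finally show ?thesis using True by (simp add: chart_tangent_def)
  next
    case False
    then show ?thesis using lie_bracket_nonsmooth[OF X Y] by (simp add: chart_tangent_def)
  qed
  then have "lie_bracket G X Y = chart_tangent (atlas G) U \<phi> \<one> (z v w - z w v)" by (rule ext)
  then show ?thesis
    using chart_tangent_in_tangent_space[OF smooth_atlas U] by (simp add: lie_algebra_def)
qed

lemma lie_bracket_zero:
  assumes "X \<in> lie_algebra G"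
  shows "lie_bracket G X (\<lambda>f. 0) = (\<lambda>f. 0)" and "lie_bracket G (\<lambda>f. 0) X = (\<lambda>f. 0)"
proof -
  have "lie_bracket G X (\<lambda>f. 0) f = 0 \<and> lie_bracket G (\<lambda>f. 0) X f = 0" for f
    using lie_bracket_apply[OF assms lie_algebra_zero, of f] lie_bracket_apply[OF lie_algebra_zero assms, of f]
      lie_bracket_nonsmooth[OF assms lie_algebra_zero, of f] lie_bracket_nonsmooth[OF lie_algebra_zero assms, of f]
      lie_algebra_const[OF assms]
    by (cases "f \<in> smooth_functions (atlas G)") simp_all
  then show "lie_bracket G X (\<lambda>f. 0) = (\<lambda>f. 0)" "lie_bracket G (\<lambda>f. 0) X = (\<lambda>f. 0)" by auto
qed

lemma left_invariant_metric_one: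
  assumes "X \<in> lie_algebra G" "Y \<in> lie_algebra G"
  shows "left_invariant_metric G ip \<one> X Y = ip X Y"
proof -
  have "differential (atlas G) (\<lambda>q. inv \<one> \<otimes> q) Z = Z" if Z: "Z \<in> lie_algebra G" for Z
  proof
    fix f
    have "Z (\<lambda>q. f (\<one> \<otimes> q)) = Z f" by (rule lie_algebra_cong[OF Z]) simp
    then show "differential (atlas G) (\<lambda>q. inv \<one> \<otimes> q) Z f = Z f"
      using lie_algebra_nonsmooth[OF Z] by (simp add: differential_def o_def)
  qed
  then show ?thesis using assms by (simp add: left_invariant_metric_def)
qed

text \<open>
  At the identity the left-invariant metric is the given inner product, but only on the Lie algebra; the
  statement therefore rests on the closure of the Lie algebra under brackets.
\<close>

lemma cyclic_left_invariant_metric_iff: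
  "cyclic_metric G (left_invariant_metric G ip) \<longleftrightarrow>
     (\<forall>X\<in>lie_algebra G. \<forall>Y\<in>lie_algebra G. \<forall>Z\<in>lie_algebra G.
        ip (lie_bracket G X Y) Z + ip (lie_bracket G Y Z) X + ip (lie_bracket G Z X) Y = 0)"
  unfolding cyclic_metric_def by (simp add: left_invariant_metric_one lie_bracket_in_lie_algebra)

end


section \<open>The Lie algebra of a semidirect product\<close>

locale smooth_semidirect =
  G\<^sub>1: lie_group G\<^sub>1 + G\<^sub>2: lie_group G\<^sub>2
  for G\<^sub>1 :: "('a, 'e::real_inner) lie_struct" and G\<^sub>2 :: "('b, 'f::real_inner) lie_struct" +
  fixes \<pi> :: "'a \<Rightarrow> 'b \<Rightarrow> 'b"
  assumes smooth_action: "smooth_action G\<^sub>1 G\<^sub>2 \<pi>"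
begin

abbreviation "A\<^sub>1 \<equiv> atlas G\<^sub>1"
abbreviation "A\<^sub>2 \<equiv> atlas G\<^sub>2"
abbreviation "A\<^sub>P \<equiv> prod_atlas A\<^sub>1 A\<^sub>2"
abbreviation "S \<equiv> semidirect G\<^sub>1 \<pi> G\<^sub>2"
abbreviation "d\<^sub>1 \<equiv> differential A\<^sub>1 fst"
abbreviation "d\<^sub>2 \<equiv> differential A\<^sub>2 snd"

sublocale M\<^sub>1: smooth_monoid G\<^sub>1 by (rule G\<^sub>1.smooth_monoid)
sublocale M\<^sub>2: smooth_monoid G\<^sub>2 by (rule G\<^sub>2.smooth_monoid)

lemma smooth_pi: "smooth_map A\<^sub>P A\<^sub>2 (\<lambda>(g, h). \<pi> g h)"
  using smooth_action by (simp add: smooth_action_def)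

lemma pi_hom: "\<pi> \<in> hom G\<^sub>1 (AutoGroup G\<^sub>2)"
  using smooth_action by (simp add: smooth_action_def)

lemma pi_auto: "g \<in> carrier G\<^sub>1 \<Longrightarrow> \<pi> g \<in> auto G\<^sub>2"
  using hom_in_carrier[OF pi_hom] by (simp add: AutoGroup_def)

lemma pi_endo: "g \<in> carrier G\<^sub>1 \<Longrightarrow> \<pi> g \<in> hom G\<^sub>2 G\<^sub>2"
  using pi_auto by (simp add: auto_def)

lemma pi_closed: "g \<in> carrier G\<^sub>1 \<Longrightarrow> h \<in> carrier G\<^sub>2 \<Longrightarrow> \<pi> g h \<in> carrier G\<^sub>2"
  using hom_in_carrier[OF pi_endo] by blast

lemma pi_mult_right:
  "g \<in> carrier G\<^sub>1 \<Longrightarrow> h \<in> carrier G\<^sub>2 \<Longrightarrow> h' \<in> carrier G\<^sub>2 \<Longrightarrow> \<pi> g (h \<otimes>\<^bsub>G\<^sub>2\<^esub> h') = \<pi> g h \<otimes>\<^bsub>G\<^sub>2\<^esub> \<pi> g h'"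
  using hom_mult[OF pi_endo] by blast

lemma pi_one_right: "g \<in> carrier G\<^sub>1 \<Longrightarrow> \<pi> g \<one>\<^bsub>G\<^sub>2\<^esub> = \<one>\<^bsub>G\<^sub>2\<^esub>"
  using hom_one[OF pi_endo G\<^sub>2.is_group G\<^sub>2.is_group] .

lemma pi_one_left: "h \<in> carrier G\<^sub>2 \<Longrightarrow> \<pi> \<one>\<^bsub>G\<^sub>1\<^esub> h = h"
  using hom_one[OF pi_hom G\<^sub>1.is_group G\<^sub>2.AutoGroup] by (simp add: AutoGroup_def BijGroup_def)

lemma pi_mult_left:
  assumes "g \<in> carrier G\<^sub>1" "g' \<in> carrier G\<^sub>1" "h \<in> carrier G\<^sub>2"
  shows "\<pi> (g \<otimes>\<^bsub>G\<^sub>1\<^esub> g') h = \<pi> g (\<pi> g' h)"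
proof -
  have "\<pi> g \<in> Bij (carrier G\<^sub>2)" "\<pi> g' \<in> Bij (carrier G\<^sub>2)"
    using pi_auto assms by (auto simp: auto_def)
  then show ?thesis
    using hom_mult[OF pi_hom assms(1,2)] assms(3) by (simp add: AutoGroup_def BijGroup_def compose_eq)
qed

lemma semidirect_simps:
  "carrier S = carrier G\<^sub>1 \<times> carrier G\<^sub>2" "atlas S = A\<^sub>P" "\<one>\<^bsub>S\<^esub> = (\<one>\<^bsub>G\<^sub>1\<^esub>, \<one>\<^bsub>G\<^sub>2\<^esub>)"
  "p \<otimes>\<^bsub>S\<^esub> q = (fst p \<otimes>\<^bsub>G\<^sub>1\<^esub> fst q, snd p \<otimes>\<^bsub>G\<^sub>2\<^esub> \<pi> (fst p) (snd q))"
  by (simp_all add: semidirect_def case_prod_beta)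

lemmas atlas_prod = smooth_atlas_prod[OF M\<^sub>1.smooth_atlas M\<^sub>2.smooth_atlas]

text \<open>
  The second component of the product of \<open>p\<close> and \<open>q\<close> involves \<open>q\<close> only through its own second component.
  Isolating this dependence allows \<open>q\<close> to vary in \<open>G\<^sub>2\<close> alone when the bracket is computed.
\<close>

lemma smooth_mult_pi:
  "smooth_map (prod_atlas A\<^sub>P A\<^sub>2) A\<^sub>2 (\<lambda>z. snd (fst z) \<otimes>\<^bsub>G\<^sub>2\<^esub> \<pi> (fst (fst z)) (snd z))"
proof -
  note D = smooth_atlas_prod[OF atlas_prod M\<^sub>2.smooth_atlas]
  note f = smooth_map_fst[OF atlas_prod M\<^sub>2.smooth_atlas] and s = smooth_map_snd[OF atlas_prod M\<^sub>2.smooth_atlas]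
  note f1 = smooth_map_compose[OF D atlas_prod f smooth_map_fst[OF M\<^sub>1.smooth_atlas M\<^sub>2.smooth_atlas]]
  note f2 = smooth_map_compose[OF D atlas_prod f smooth_map_snd[OF M\<^sub>1.smooth_atlas M\<^sub>2.smooth_atlas]]
  note p = smooth_map_compose[OF D atlas_prod smooth_map_Pair[OF D f1 s] smooth_pi]
  show ?thesis
    using smooth_map_compose[OF D smooth_atlas_prod[OF M\<^sub>2.smooth_atlas M\<^sub>2.smooth_atlas] smooth_map_Pair[OF D f2 p] M\<^sub>2.smooth_mult]
    by simp
qed

sublocale MS: smooth_monoid S
proof (unfold_locales)
  note D = smooth_atlas_prod[OF atlas_prod atlas_prod]
  note f = smooth_map_fst[OF atlas_prod atlas_prod] and s = smooth_map_snd[OF atlas_prod atlas_prod]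
  note s1 = smooth_map_compose[OF D atlas_prod s smooth_map_fst[OF M\<^sub>1.smooth_atlas M\<^sub>2.smooth_atlas]]
  note s2 = smooth_map_compose[OF D atlas_prod s smooth_map_snd[OF M\<^sub>1.smooth_atlas M\<^sub>2.smooth_atlas]]
  note f1 = smooth_map_compose[OF D atlas_prod f smooth_map_fst[OF M\<^sub>1.smooth_atlas M\<^sub>2.smooth_atlas]]
  note m1 = smooth_map_compose[OF D smooth_atlas_prod[OF M\<^sub>1.smooth_atlas M\<^sub>1.smooth_atlas] smooth_map_Pair[OF D f1 s1] M\<^sub>1.smooth_mult]
  note m2 = smooth_map_compose[OF D smooth_atlas_prod[OF atlas_prod M\<^sub>2.smooth_atlas] smooth_map_Pair[OF D f s2] smooth_mult_pi]
  show "smooth_map (prod_atlas (atlas S) (atlas S)) (atlas S) (\<lambda>(x, y). x \<otimes>\<^bsub>S\<^esub> y)"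
    using smooth_map_Pair[OF D m1 m2] by (simp add: semidirect_simps case_prod_unfold)
  show "smooth_atlas (atlas S)" by (simp add: semidirect_simps atlas_prod)
  show "points (atlas S) = carrier S"
    by (simp add: semidirect_simps points_prod_atlas G\<^sub>1.points_atlas G\<^sub>2.points_atlas)
qed (auto simp: semidirect_simps pi_closed pi_one_left pi_one_right pi_mult_left pi_mult_right
       G\<^sub>1.m_assoc G\<^sub>2.m_assoc)

lemma lie_algebra_semidirect: "lie_algebra S = tangent_space A\<^sub>P (\<one>\<^bsub>G\<^sub>1\<^esub>, \<one>\<^bsub>G\<^sub>2\<^esub>)"
  by (simp add: lie_algebra_def semidirect_simps)

lemmas split_prod = tangent_space_prod_split[OF M\<^sub>1.smooth_atlas M\<^sub>2.smooth_atlas M\<^sub>1.one_in_points M\<^sub>2.one_in_points,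
    folded lie_algebra_semidirect lie_algebra_def]
lemmas pair_prod = tangent_space_prod_pair[OF M\<^sub>1.smooth_atlas M\<^sub>2.smooth_atlas M\<^sub>1.one_in_points M\<^sub>2.one_in_points,
    folded lie_algebra_semidirect lie_algebra_def]

lemma action_derivation_apply:
  assumes "f \<in> smooth_functions A\<^sub>2"
  shows "action_derivation G\<^sub>2 \<pi> X Y f = X (\<lambda>g. Y (\<lambda>h. f (\<pi> g h)))"
  using assms by (simp add: action_derivation_def differential_apply)

lemma action_derivation_nonsmooth:
  assumes "X \<in> lie_algebra G\<^sub>1" "f \<notin> smooth_functions A\<^sub>2"
  shows "action_derivation G\<^sub>2 \<pi> X Y f = 0"
  using assms M\<^sub>1.lie_algebra_const by (simp add: action_derivation_def differential_def)

text \<open>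
  Every \<open>\<pi> g\<close> fixes the identity, so the partial derivative of the action in the direction of \<open>G\<^sub>1\<close> is zero
  there. The second-order part of the iterated derivative has this zero vector as one of its directions.
\<close>

lemma action_derivation_in_lie_algebra:
  assumes X: "X \<in> lie_algebra G\<^sub>1" and Y: "Y \<in> lie_algebra G\<^sub>2"
  shows "action_derivation G\<^sub>2 \<pi> X Y \<in> lie_algebra G\<^sub>2"
proof -
  obtain U \<phi> where U: "(U, \<phi>) \<in> A\<^sub>1" "\<one>\<^bsub>G\<^sub>1\<^esub> \<in> U" using M\<^sub>1.one_in_points by (rule pointsE)
  obtain V \<psi> where V: "(V, \<psi>) \<in> A\<^sub>2" "\<one>\<^bsub>G\<^sub>2\<^esub> \<in> V" using M\<^sub>2.one_in_points by (rule pointsE)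
  have UG: "U \<subseteq> carrier G\<^sub>1" using pointsI[OF U(1)] M\<^sub>1.points_atlas by blast
  note inj = smooth_atlasD(1)[OF M\<^sub>1.smooth_atlas U(1)] smooth_atlasD(1)[OF M\<^sub>2.smooth_atlas V(1)]
  obtain v where v: "X = chart_tangent A\<^sub>1 U \<phi> \<one>\<^bsub>G\<^sub>1\<^esub> v"
    using tangent_space_chartE[OF M\<^sub>1.smooth_atlas U X[unfolded lie_algebra_def]] .
  obtain w where w: "Y = chart_tangent A\<^sub>2 V \<psi> \<one>\<^bsub>G\<^sub>2\<^esub> w"
    using tangent_space_chartE[OF M\<^sub>2.smooth_atlas V Y[unfolded lie_algebra_def]] .
  let ?F = "\<lambda>(g, h). \<pi> g h" and ?e\<^sub>1 = "\<phi> \<one>\<^bsub>G\<^sub>1\<^esub>" and ?e\<^sub>2 = "\<psi> \<one>\<^bsub>G\<^sub>2\<^esub>"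
  define H where "H = \<psi> \<circ> ?F \<circ> inv_into (U \<times> V) (map_prod \<phi> \<psi>)"
  have H: "H (a, b) = \<psi> (\<pi> (inv_into U \<phi> a) (inv_into V \<psi> b))" if "a \<in> \<phi> ` U" "b \<in> \<psi> ` V" for a b
    using inv_into_map_prod[OF inj that] by (simp add: H_def)
  let ?N = "map_prod \<phi> \<psi> ` ((U \<times> V) \<inter> ?F -` V)"
  have "smooth_on ?N H" unfolding H_def
    by (rule smooth_mapD(3)[OF smooth_pi prod_atlasI[OF U(1) V(1)] V(1)])
  moreover have "(?e\<^sub>1, ?e\<^sub>2) \<in> ?N" using U V pi_one_right by force
  ultimately have dH: "(H has_derivative dir_deriv H (?e\<^sub>1, ?e\<^sub>2)) (at (?e\<^sub>1, ?e\<^sub>2))"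
    by (rule smooth_on_has_derivative)
  have e: "?e\<^sub>1 \<in> \<phi> ` U" "?e\<^sub>2 \<in> \<psi> ` V" using U V by simp_all
  have "dir_deriv (\<lambda>a. H (a, ?e\<^sub>2)) ?e\<^sub>1 = dir_deriv (\<lambda>a. ?e\<^sub>2) ?e\<^sub>1"
    by (rule dir_deriv_cong[OF smooth_atlasD(2)[OF M\<^sub>1.smooth_atlas U(1)] e(1)])
      (use UG inj V H[OF _ e(2)] pi_one_right in auto)
  then have H1: "dir_deriv H (?e\<^sub>1, ?e\<^sub>2) (u, 0) = 0" for u
    using dir_deriv_slice(1)[OF dH, symmetric] by simp
  define z where "z = dir_deriv (\<lambda>z. dir_deriv H z (0, w)) (?e\<^sub>1, ?e\<^sub>2) (v, 0)"
  have "action_derivation G\<^sub>2 \<pi> X Y f = chart_tangent A\<^sub>2 V \<psi> \<one>\<^bsub>G\<^sub>2\<^esub> z f" for f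
  proof (cases "f \<in> smooth_functions A\<^sub>2")
    case True
    let ?k = "f \<circ> inv_into V \<psi>"
    have "linear (dir_deriv (\<lambda>y. dir_deriv ?k y u) ?e\<^sub>2)" for u
      using has_derivative_linear[OF smooth_on_has_derivative[OF smooth_on_dir_deriv[OF
          smooth_functionsD[OF M\<^sub>2.smooth_atlas True V(1)]] e(2)]] .
    note lin = linear_0[OF this]
    have "chart_tangent A\<^sub>1 U \<phi> \<one>\<^bsub>G\<^sub>1\<^esub> v (\<lambda>p. chart_tangent A\<^sub>2 V \<psi> \<one>\<^bsub>G\<^sub>2\<^esub> w (\<lambda>q. f (\<pi> p q))) = dir_deriv ?k ?e\<^sub>2 z"
      using mixed_derivative_in_charts[OF M\<^sub>1.smooth_atlas M\<^sub>2.smooth_atlas M\<^sub>2.smooth_atlas U V V(1) _ smooth_pi True, of v w]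
        V(2) pi_one_right by (simp add: z_def H_def[symmetric] H1 lin)
    then show ?thesis using True by (simp add: v w action_derivation_apply chart_tangent_def)
  next
    case False
    then show ?thesis using action_derivation_nonsmooth[OF X] by (simp add: chart_tangent_def)
  qed
  then have "action_derivation G\<^sub>2 \<pi> X Y = chart_tangent A\<^sub>2 V \<psi> \<one>\<^bsub>G\<^sub>2\<^esub> z" by (rule ext)
  then show ?thesis
    using chart_tangent_in_tangent_space[OF M\<^sub>2.smooth_atlas V] by (simp add: lie_algebra_def)
qed

lemma action_derivation_zero:
  "action_derivation G\<^sub>2 \<pi> (\<lambda>f. 0) Y = (\<lambda>f. 0)"
  "X \<in> lie_algebra G\<^sub>1 \<Longrightarrow> action_derivation G\<^sub>2 \<pi> X (\<lambda>f. 0) = (\<lambda>f. 0)"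
  using M\<^sub>1.lie_algebra_const by (auto simp: action_derivation_def differential_def)

lemma lie_bracket_fst:
  assumes X: "X \<in> lie_algebra S" and Y: "Y \<in> lie_algebra S"
  shows "d\<^sub>1 (lie_bracket S X Y) = lie_bracket G\<^sub>1 (d\<^sub>1 X) (d\<^sub>1 Y)"
proof
  fix f
  note fst = smooth_map_fst[OF M\<^sub>1.smooth_atlas M\<^sub>2.smooth_atlas]
  show "d\<^sub>1 (lie_bracket S X Y) f = lie_bracket G\<^sub>1 (d\<^sub>1 X) (d\<^sub>1 Y) f"
  proof (cases "f \<in> smooth_functions A\<^sub>1")
    case True
    have XY: "X (\<lambda>p. Y (\<lambda>q. f (fst p \<otimes>\<^bsub>G\<^sub>1\<^esub> fst q))) = d\<^sub>1 X (\<lambda>p. d\<^sub>1 Y (\<lambda>q. f (p \<otimes>\<^bsub>G\<^sub>1\<^esub> q)))"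
      if X: "X \<in> lie_algebra S" and Y: "Y \<in> lie_algebra S" for X Y
    proof -
      have "Y (\<lambda>q. f (fst p \<otimes>\<^bsub>G\<^sub>1\<^esub> fst q)) = d\<^sub>1 Y (\<lambda>q. f (fst p \<otimes>\<^bsub>G\<^sub>1\<^esub> q))" if "p \<in> carrier S" for p
      proof -
        have "fst p \<in> points A\<^sub>1" using that by (auto simp: semidirect_simps G\<^sub>1.points_atlas)
        from smooth_functions_compose[OF M\<^sub>1.smooth_atlas smooth_atlas_prod[OF M\<^sub>1.smooth_atlas M\<^sub>1.smooth_atlas]
            smooth_map_slice(2)[OF M\<^sub>1.smooth_atlas M\<^sub>1.smooth_atlas this] M\<^sub>1.smooth_functions_mult[OF True]]
        show ?thesis by (simp add: differential_apply)
      qed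
      then have "X (\<lambda>p. Y (\<lambda>q. f (fst p \<otimes>\<^bsub>G\<^sub>1\<^esub> fst q))) = X (\<lambda>p. d\<^sub>1 Y (\<lambda>q. f (fst p \<otimes>\<^bsub>G\<^sub>1\<^esub> q)))"
        by (rule MS.lie_algebra_cong[OF X])
      moreover have "(\<lambda>p. d\<^sub>1 Y (\<lambda>q. f (p \<otimes>\<^bsub>G\<^sub>1\<^esub> q))) \<in> smooth_functions A\<^sub>1"
        using smooth_functions_partial_derivative[OF M\<^sub>1.smooth_atlas M\<^sub>1.smooth_atlas M\<^sub>1.one_in_points
          M\<^sub>1.smooth_functions_mult[OF True] split_prod(1)[OF Y, unfolded lie_algebra_def]] by simp
      ultimately show ?thesis by (simp add: differential_apply)
    qed
    have "(\<lambda>p. f (fst p)) \<in> smooth_functions (atlas S)"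
      using smooth_functions_compose[OF atlas_prod M\<^sub>1.smooth_atlas fst True] by (simp add: semidirect_simps)
    from MS.lie_bracket_apply[OF X Y this] show ?thesis
      using M\<^sub>1.lie_bracket_apply[OF split_prod(1)[OF X] split_prod(1)[OF Y] True] XY[OF X Y] XY[OF Y X] True
      by (simp add: differential_apply semidirect_simps)
  next
    case False
    then show ?thesis
      using M\<^sub>1.lie_bracket_nonsmooth[OF split_prod(1)[OF X] split_prod(1)[OF Y]] by (simp add: differential_def)
  qed
qed

text \<open>
  The function of \<open>p\<close> that is differentiated along \<open>X\<close> lives on the product and splits into its
  derivative along \<open>G\<^sub>1\<close>, where the second component is the identity and only the action remains, and its
  derivative along \<open>G\<^sub>2\<close>, where the action is trivial and only the multiplication of \<open>G\<^sub>2\<close> remains.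
\<close>

lemma lie_bracket_snd:
  assumes X: "X \<in> lie_algebra S" and Y: "Y \<in> lie_algebra S"
  shows "d\<^sub>2 (lie_bracket S X Y) = (\<lambda>f. lie_bracket G\<^sub>2 (d\<^sub>2 X) (d\<^sub>2 Y) f +
     action_derivation G\<^sub>2 \<pi> (d\<^sub>1 X) (d\<^sub>2 Y) f - action_derivation G\<^sub>2 \<pi> (d\<^sub>1 Y) (d\<^sub>2 X) f)"
proof
  fix f
  show "d\<^sub>2 (lie_bracket S X Y) f = lie_bracket G\<^sub>2 (d\<^sub>2 X) (d\<^sub>2 Y) f +
     action_derivation G\<^sub>2 \<pi> (d\<^sub>1 X) (d\<^sub>2 Y) f - action_derivation G\<^sub>2 \<pi> (d\<^sub>1 Y) (d\<^sub>2 X) f"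
  proof (cases "f \<in> smooth_functions A\<^sub>2")
    case True
    note D = smooth_atlas_prod[OF atlas_prod M\<^sub>2.smooth_atlas]
    have M: "(\<lambda>z. f (snd (fst z) \<otimes>\<^bsub>G\<^sub>2\<^esub> \<pi> (fst (fst z)) (snd z))) \<in> smooth_functions (prod_atlas A\<^sub>P A\<^sub>2)"
      by (rule smooth_functions_compose[OF D M\<^sub>2.smooth_atlas smooth_mult_pi True])
    have XY: "X (\<lambda>p. Y (\<lambda>q. f (snd p \<otimes>\<^bsub>G\<^sub>2\<^esub> \<pi> (fst p) (snd q)))) =
        action_derivation G\<^sub>2 \<pi> (d\<^sub>1 X) (d\<^sub>2 Y) f + d\<^sub>2 X (\<lambda>p. d\<^sub>2 Y (\<lambda>q. f (p \<otimes>\<^bsub>G\<^sub>2\<^esub> q)))"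
      if X: "X \<in> lie_algebra S" and Y: "Y \<in> lie_algebra S" for X Y
    proof -
      note X1 = split_prod(1)[OF X] and X2 = split_prod(2)[OF X] and Y2 = split_prod(2)[OF Y]
      let ?H = "\<lambda>p. d\<^sub>2 Y (\<lambda>q. f (snd p \<otimes>\<^bsub>G\<^sub>2\<^esub> \<pi> (fst p) q))"
      have "Y (\<lambda>q. f (snd p \<otimes>\<^bsub>G\<^sub>2\<^esub> \<pi> (fst p) (snd q))) = ?H p" if "p \<in> carrier S" for p
      proof -
        have "p \<in> points A\<^sub>P" using that MS.points_atlas by (simp add: semidirect_simps)
        from smooth_functions_compose[OF M\<^sub>2.smooth_atlas D smooth_map_slice(2)[OF atlas_prod M\<^sub>2.smooth_atlas this] M]
        show ?thesis by (simp add: differential_apply)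
      qed
      then have "X (\<lambda>p. Y (\<lambda>q. f (snd p \<otimes>\<^bsub>G\<^sub>2\<^esub> \<pi> (fst p) (snd q)))) = X ?H"
        by (rule MS.lie_algebra_cong[OF X])
      also have "\<dots> = d\<^sub>1 X (\<lambda>g. ?H (g, \<one>\<^bsub>G\<^sub>2\<^esub>)) + d\<^sub>2 X (\<lambda>h. ?H (\<one>\<^bsub>G\<^sub>1\<^esub>, h))"
        using smooth_functions_partial_derivative[OF atlas_prod M\<^sub>2.smooth_atlas M\<^sub>2.one_in_points M Y2[unfolded lie_algebra_def]]
        by (intro split_prod(3)[OF X]) simp
      also have "d\<^sub>1 X (\<lambda>g. ?H (g, \<one>\<^bsub>G\<^sub>2\<^esub>)) = d\<^sub>1 X (\<lambda>g. d\<^sub>2 Y (\<lambda>h. f (\<pi> g h)))"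
        by (intro M\<^sub>1.lie_algebra_cong[OF X1]) (simp, intro M\<^sub>2.lie_algebra_cong[OF Y2], simp add: pi_closed)
      also have "d\<^sub>2 X (\<lambda>h. ?H (\<one>\<^bsub>G\<^sub>1\<^esub>, h)) = d\<^sub>2 X (\<lambda>p. d\<^sub>2 Y (\<lambda>q. f (p \<otimes>\<^bsub>G\<^sub>2\<^esub> q)))"
        by (intro M\<^sub>2.lie_algebra_cong[OF X2]) (simp, intro M\<^sub>2.lie_algebra_cong[OF Y2], simp add: pi_one_left)
      finally show ?thesis using True by (simp add: action_derivation_apply)
    qed
    have "(\<lambda>p. f (snd p)) \<in> smooth_functions (atlas S)"
      using smooth_functions_compose[OF atlas_prod M\<^sub>2.smooth_atlas smooth_map_snd[OF M\<^sub>1.smooth_atlas M\<^sub>2.smooth_atlas] True]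
      by (simp add: semidirect_simps)
    from MS.lie_bracket_apply[OF X Y this] show ?thesis
      using M\<^sub>2.lie_bracket_apply[OF split_prod(2)[OF X] split_prod(2)[OF Y] True] XY[OF X Y] XY[OF Y X] True
      by (simp add: differential_apply semidirect_simps)
  next
    case False
    then show ?thesis
      using M\<^sub>2.lie_bracket_nonsmooth[OF split_prod(2)[OF X] split_prod(2)[OF Y]]
        action_derivation_nonsmooth[OF split_prod(1)] X Y by (simp add: differential_def)
  qed
qed

end


section \<open>Cyclic metrics on a semidirect product\<close>

lemma inner_product_onD:
  assumes "inner_product_on T ip"
  shows "X \<in> T \<Longrightarrow> Y \<in> T \<Longrightarrow> Z \<in> T \<Longrightarrow> ip (\<lambda>f. X f + Y f) Z = ip X Z + ip Y Z"
    and "X \<in> T \<Longrightarrow> Y \<in> T \<Longrightarrow> ip (\<lambda>f. c * X f) Y = c * ip X Y"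
    and "X \<in> T \<Longrightarrow> Y \<in> T \<Longrightarrow> ip X Y = ip Y X"
    and "X \<in> T \<Longrightarrow> X \<noteq> (\<lambda>f. 0) \<Longrightarrow> ip X X > 0"
  using assms unfolding inner_product_on_def by blast+

lemma inner_product_on_zero:
  assumes "inner_product_on T ip" "(\<lambda>f. 0) \<in> T" "X \<in> T"
  shows "ip (\<lambda>f. 0) X = 0" and "ip X (\<lambda>f. 0) = 0"
proof -
  show "ip (\<lambda>f. 0) X = 0" using inner_product_onD(2)[OF assms, of 0] by simp
  then show "ip X (\<lambda>f. 0) = 0" using inner_product_onD(3)[OF assms] by simp
qed

lemma differential_add: "differential B F (\<lambda>f. X f + Y f) = (\<lambda>f. differential B F X f + differential B F Y f)"
  and differential_scale: "differential B F (\<lambda>f. c * X f) = (\<lambda>f. c * differential B F X f)"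
  by (auto simp: differential_def)

context smooth_semidirect
begin

text \<open>
  Definiteness holds because a tangent vector of the product with zero projections is zero.
\<close>

lemma inner_product_on_product_inner:
  assumes 1: "inner_product_on (lie_algebra G\<^sub>1) ip\<^sub>1" and 2: "inner_product_on (lie_algebra G\<^sub>2) ip\<^sub>2"
  shows "inner_product_on (lie_algebra S) (product_inner G\<^sub>1 G\<^sub>2 ip\<^sub>1 ip\<^sub>2)"
proof -
  note p = product_inner_def differential_add differential_scale split_prod(1,2)
  have pos: "product_inner G\<^sub>1 G\<^sub>2 ip\<^sub>1 ip\<^sub>2 X X > 0" if X: "X \<in> lie_algebra S" "X \<noteq> (\<lambda>f. 0)" for X
  proof -
    note X1 = split_prod(1)[OF X(1)] and X2 = split_prod(2)[OF X(1)]
    have "d\<^sub>1 X \<noteq> (\<lambda>f. 0) \<or> d\<^sub>2 X \<noteq> (\<lambda>f. 0)"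
    proof (rule ccontr)
      assume "\<not> ?thesis"
      then have "X f = 0" for f
        using split_prod(3)[OF X(1), of f] MS.lie_algebra_nonsmooth[OF X(1), of f]
        by (cases "f \<in> smooth_functions (atlas S)") (auto simp: semidirect_simps)
      with X(2) show False by auto
    qed
    moreover have "ip\<^sub>1 (d\<^sub>1 X) (d\<^sub>1 X) \<ge> 0" "ip\<^sub>2 (d\<^sub>2 X) (d\<^sub>2 X) \<ge> 0"
      using inner_product_onD(4)[OF 1 X1] inner_product_onD(4)[OF 2 X2]
        inner_product_on_zero(1)[OF 1 M\<^sub>1.lie_algebra_zero M\<^sub>1.lie_algebra_zero]
        inner_product_on_zero(1)[OF 2 M\<^sub>2.lie_algebra_zero M\<^sub>2.lie_algebra_zero]
      by (metis less_imp_le order_refl)+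
    ultimately show ?thesis
      using inner_product_onD(4)[OF 1 X1] inner_product_onD(4)[OF 2 X2]
      unfolding product_inner_def by (metis add_nonneg_pos add_pos_nonneg)
  qed
  show ?thesis
    unfolding inner_product_on_def using pos
    by (auto simp: p inner_product_onD(1,2)[OF 1] inner_product_onD(1,2)[OF 2] distrib_left
        intro!: arg_cong2[of _ _ _ _ "(+)"] inner_product_onD(3)[OF 1] inner_product_onD(3)[OF 2])
qed

text \<open>
  Splitting the three summands of the second component of the bracket requires each of them to lie in
  the Lie algebra, where the inner product is additive.
\<close>

lemma product_inner_lie_bracket:
  assumes 1: "inner_product_on (lie_algebra G\<^sub>1) ip\<^sub>1" and 2: "inner_product_on (lie_algebra G\<^sub>2) ip\<^sub>2"
    and X: "X \<in> lie_algebra S" and Y: "Y \<in> lie_algebra S" and Z: "Z \<in> lie_algebra S"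
  shows "product_inner G\<^sub>1 G\<^sub>2 ip\<^sub>1 ip\<^sub>2 (lie_bracket S X Y) Z =
     ip\<^sub>1 (lie_bracket G\<^sub>1 (d\<^sub>1 X) (d\<^sub>1 Y)) (d\<^sub>1 Z) + ip\<^sub>2 (lie_bracket G\<^sub>2 (d\<^sub>2 X) (d\<^sub>2 Y)) (d\<^sub>2 Z) +
     ip\<^sub>2 (action_derivation G\<^sub>2 \<pi> (d\<^sub>1 X) (d\<^sub>2 Y)) (d\<^sub>2 Z) -
     ip\<^sub>2 (action_derivation G\<^sub>2 \<pi> (d\<^sub>1 Y) (d\<^sub>2 X)) (d\<^sub>2 Z)"
proof -
  define b where "b = lie_bracket G\<^sub>2 (d\<^sub>2 X) (d\<^sub>2 Y)"
  define a where "a = action_derivation G\<^sub>2 \<pi> (d\<^sub>1 X) (d\<^sub>2 Y)"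
  define a' where "a' = action_derivation G\<^sub>2 \<pi> (d\<^sub>1 Y) (d\<^sub>2 X)"
  have m: "b \<in> lie_algebra G\<^sub>2" "a \<in> lie_algebra G\<^sub>2" "a' \<in> lie_algebra G\<^sub>2" "d\<^sub>2 Z \<in> lie_algebra G\<^sub>2"
    unfolding a_def a'_def b_def
    by (intro M\<^sub>2.lie_bracket_in_lie_algebra action_derivation_in_lie_algebra split_prod(1,2) X Y Z)+
  note m' = M\<^sub>2.lie_algebra_add[OF m(1,2)] M\<^sub>2.lie_algebra_scale[OF m(3), of "-1"]
  have "ip\<^sub>2 (\<lambda>f. (b f + a f) + (-1) * a' f) (d\<^sub>2 Z) = ip\<^sub>2 b (d\<^sub>2 Z) + ip\<^sub>2 a (d\<^sub>2 Z) + (-1) * ip\<^sub>2 a' (d\<^sub>2 Z)"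
    by (simp only: inner_product_onD(1)[OF 2 m' m(4)] inner_product_onD(1)[OF 2 m(1,2,4)] inner_product_onD(2)[OF 2 m(3,4)])
  then show ?thesis
    by (simp add: product_inner_def lie_bracket_fst[OF X Y] lie_bracket_snd[OF X Y] flip: a_def a'_def b_def)
qed

end

theorem lemma5p3:
  fixes G\<^sub>1 :: "('a, 'e::real_inner) lie_struct"
    and G\<^sub>2 :: "('b, 'f::real_inner) lie_struct"
    and ip\<^sub>1 :: "'a tangent \<Rightarrow> 'a tangent \<Rightarrow> real"
    and ip\<^sub>2 :: "'b tangent \<Rightarrow> 'b tangent \<Rightarrow> real"
    and \<pi> :: "'a \<Rightarrow> 'b \<Rightarrow> 'b"
  assumes "lie_group G\<^sub>1"
    and "lie_group G\<^sub>2"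
    and "inner_product_on (lie_algebra G\<^sub>1) ip\<^sub>1"
    and "inner_product_on (lie_algebra G\<^sub>2) ip\<^sub>2"
    and "smooth_action G\<^sub>1 G\<^sub>2 \<pi>"
  shows "defines_cyclic_metric (semidirect G\<^sub>1 \<pi> G\<^sub>2) (product_inner G\<^sub>1 G\<^sub>2 ip\<^sub>1 ip\<^sub>2) \<longleftrightarrow>
     cyclic_metric G\<^sub>1 (left_invariant_metric G\<^sub>1 ip\<^sub>1) \<and>
     cyclic_metric G\<^sub>2 (left_invariant_metric G\<^sub>2 ip\<^sub>2) \<and>
     (\<forall>X\<^sub>1\<in>lie_algebra G\<^sub>1.
        selfadjoint_on (lie_algebra G\<^sub>2) ip\<^sub>2 (action_derivation G\<^sub>2 \<pi> X\<^sub>1))"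
proof -
  interpret smooth_semidirect G\<^sub>1 G\<^sub>2 \<pi>
    by (intro smooth_semidirect.intro smooth_semidirect_axioms.intro assms)
  note ip1 = assms(3) and ip2 = assms(4)
  note bracket = product_inner_lie_bracket[OF ip1 ip2]
  note sym2 = inner_product_onD(3)[OF ip2]
  note zero1 = M\<^sub>1.lie_algebra_zero and zero2 = M\<^sub>2.lie_algebra_zero
  note zero1_inner = inner_product_on_zero[OF ip1 zero1] and zero2_inner = inner_product_on_zero[OF ip2 zero2]
  note act = action_derivation_in_lie_algebra
  have lhs: "defines_cyclic_metric S (product_inner G\<^sub>1 G\<^sub>2 ip\<^sub>1 ip\<^sub>2) \<longleftrightarrow>
    (\<forall>X\<in>lie_algebra S. \<forall>Y\<in>lie_algebra S. \<forall>Z\<in>lie_algebra S.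
       product_inner G\<^sub>1 G\<^sub>2 ip\<^sub>1 ip\<^sub>2 (lie_bracket S X Y) Z + product_inner G\<^sub>1 G\<^sub>2 ip\<^sub>1 ip\<^sub>2 (lie_bracket S Y Z) X +
       product_inner G\<^sub>1 G\<^sub>2 ip\<^sub>1 ip\<^sub>2 (lie_bracket S Z X) Y = 0)" (is "_ \<longleftrightarrow> ?cyclic")
    unfolding defines_cyclic_metric_def MS.cyclic_left_invariant_metric_iff
    using inner_product_on_product_inner[OF ip1 ip2] by blast
  \<comment> \<open>The cyclic identity of the product, written in components. Any six components occur, because
     tangent vectors of the factors can be paired.\<close>
  have cyc: "ip\<^sub>1 (lie_bracket G\<^sub>1 X\<^sub>1 Y\<^sub>1) Z\<^sub>1 + ip\<^sub>1 (lie_bracket G\<^sub>1 Y\<^sub>1 Z\<^sub>1) X\<^sub>1 + ip\<^sub>1 (lie_bracket G\<^sub>1 Z\<^sub>1 X\<^sub>1) Y\<^sub>1 +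
      (ip\<^sub>2 (lie_bracket G\<^sub>2 X\<^sub>2 Y\<^sub>2) Z\<^sub>2 + ip\<^sub>2 (lie_bracket G\<^sub>2 Y\<^sub>2 Z\<^sub>2) X\<^sub>2 + ip\<^sub>2 (lie_bracket G\<^sub>2 Z\<^sub>2 X\<^sub>2) Y\<^sub>2) +
      (ip\<^sub>2 (action_derivation G\<^sub>2 \<pi> X\<^sub>1 Y\<^sub>2) Z\<^sub>2 - ip\<^sub>2 (action_derivation G\<^sub>2 \<pi> Y\<^sub>1 X\<^sub>2) Z\<^sub>2) +
      (ip\<^sub>2 (action_derivation G\<^sub>2 \<pi> Y\<^sub>1 Z\<^sub>2) X\<^sub>2 - ip\<^sub>2 (action_derivation G\<^sub>2 \<pi> Z\<^sub>1 Y\<^sub>2) X\<^sub>2) +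
      (ip\<^sub>2 (action_derivation G\<^sub>2 \<pi> Z\<^sub>1 X\<^sub>2) Y\<^sub>2 - ip\<^sub>2 (action_derivation G\<^sub>2 \<pi> X\<^sub>1 Z\<^sub>2) Y\<^sub>2) = 0"
    if c: ?cyclic and m: "X\<^sub>1 \<in> lie_algebra G\<^sub>1" "X\<^sub>2 \<in> lie_algebra G\<^sub>2" "Y\<^sub>1 \<in> lie_algebra G\<^sub>1"
      "Y\<^sub>2 \<in> lie_algebra G\<^sub>2" "Z\<^sub>1 \<in> lie_algebra G\<^sub>1" "Z\<^sub>2 \<in> lie_algebra G\<^sub>2" for X\<^sub>1 X\<^sub>2 Y\<^sub>1 Y\<^sub>2 Z\<^sub>1 Z\<^sub>2
  proof -
    obtain X where X: "X \<in> lie_algebra S" "d\<^sub>1 X = X\<^sub>1" "d\<^sub>2 X = X\<^sub>2" using pair_prod[OF m(1,2)] .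
    obtain Y where Y: "Y \<in> lie_algebra S" "d\<^sub>1 Y = Y\<^sub>1" "d\<^sub>2 Y = Y\<^sub>2" using pair_prod[OF m(3,4)] .
    obtain Z where Z: "Z \<in> lie_algebra S" "d\<^sub>1 Z = Z\<^sub>1" "d\<^sub>2 Z = Z\<^sub>2" using pair_prod[OF m(5,6)] .
    from c X(1) Y(1) Z(1) have "product_inner G\<^sub>1 G\<^sub>2 ip\<^sub>1 ip\<^sub>2 (lie_bracket S X Y) Z +
       product_inner G\<^sub>1 G\<^sub>2 ip\<^sub>1 ip\<^sub>2 (lie_bracket S Y Z) X + product_inner G\<^sub>1 G\<^sub>2 ip\<^sub>1 ip\<^sub>2 (lie_bracket S Z X) Y = 0"
      by blast
    then show ?thesis
      unfolding bracket[OF X(1) Y(1) Z(1)] bracket[OF Y(1) Z(1) X(1)] bracket[OF Z(1) X(1) Y(1)] X(2,3) Y(2,3) Z(2,3)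
      by linarith
  qed
  show ?thesis
  proof (intro iffI conjI ballI)
    assume "defines_cyclic_metric S (product_inner G\<^sub>1 G\<^sub>2 ip\<^sub>1 ip\<^sub>2)"
    then have c: ?cyclic using lhs by blast
    show "cyclic_metric G\<^sub>1 (left_invariant_metric G\<^sub>1 ip\<^sub>1)"
      unfolding M\<^sub>1.cyclic_left_invariant_metric_iff
    proof (intro ballI)
      fix X Y Z assume m: "X \<in> lie_algebra G\<^sub>1" "Y \<in> lie_algebra G\<^sub>1" "Z \<in> lie_algebra G\<^sub>1"
      \<comment> \<open>Vectors tangent to \<open>G\<^sub>1\<close>: all terms with a second component vanish.\<close>
      from cyc[OF c m(1) zero2 m(2) zero2 m(3) zero2]
      show "ip\<^sub>1 (lie_bracket G\<^sub>1 X Y) Z + ip\<^sub>1 (lie_bracket G\<^sub>1 Y Z) X + ip\<^sub>1 (lie_bracket G\<^sub>1 Z X) Y = 0"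
        by (simp add: action_derivation_zero m M\<^sub>2.lie_bracket_zero zero2 zero2_inner)
    qed
    show "cyclic_metric G\<^sub>2 (left_invariant_metric G\<^sub>2 ip\<^sub>2)"
      unfolding M\<^sub>2.cyclic_left_invariant_metric_iff
    proof (intro ballI)
      fix X Y Z assume m: "X \<in> lie_algebra G\<^sub>2" "Y \<in> lie_algebra G\<^sub>2" "Z \<in> lie_algebra G\<^sub>2"
      \<comment> \<open>Vectors tangent to \<open>G\<^sub>2\<close>: the action derivations along zero vanish.\<close>
      from cyc[OF c zero1 m(1) zero1 m(2) zero1 m(3)]
      show "ip\<^sub>2 (lie_bracket G\<^sub>2 X Y) Z + ip\<^sub>2 (lie_bracket G\<^sub>2 Y Z) X + ip\<^sub>2 (lie_bracket G\<^sub>2 Z X) Y = 0"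
        by (simp add: action_derivation_zero m M\<^sub>1.lie_bracket_zero zero1 zero1_inner zero2_inner)
    qed
    show "selfadjoint_on (lie_algebra G\<^sub>2) ip\<^sub>2 (action_derivation G\<^sub>2 \<pi> X)" if X: "X \<in> lie_algebra G\<^sub>1" for X
      unfolding selfadjoint_on_def
    proof (intro ballI)
      fix Y Z assume m: "Y \<in> lie_algebra G\<^sub>2" "Z \<in> lie_algebra G\<^sub>2"
      \<comment> \<open>One vector tangent to \<open>G\<^sub>1\<close> and two tangent to \<open>G\<^sub>2\<close>: both brackets inside the factors have a
         zero argument or are paired with zero, which leaves the two terms with \<open>\<pi>\<^sub>* X\<close>.\<close>
      from cyc[OF c X zero2 zero1 m(1) zero1 m(2)]
      have "ip\<^sub>2 (action_derivation G\<^sub>2 \<pi> X Y) Z = ip\<^sub>2 (action_derivation G\<^sub>2 \<pi> X Z) Y"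
        by (simp add: action_derivation_zero X m M\<^sub>1.lie_bracket_zero M\<^sub>2.lie_bracket_zero zero1 zero2
            zero1_inner zero2_inner M\<^sub>2.lie_bracket_in_lie_algebra)
      then show "ip\<^sub>2 (action_derivation G\<^sub>2 \<pi> X Y) Z = ip\<^sub>2 Y (action_derivation G\<^sub>2 \<pi> X Z)"
        using sym2[OF act[OF X m(2)] m(1)] by simp
    qed
  next
    assume r: "cyclic_metric G\<^sub>1 (left_invariant_metric G\<^sub>1 ip\<^sub>1) \<and>
     cyclic_metric G\<^sub>2 (left_invariant_metric G\<^sub>2 ip\<^sub>2) \<and>
     (\<forall>X\<^sub>1\<in>lie_algebra G\<^sub>1. selfadjoint_on (lie_algebra G\<^sub>2) ip\<^sub>2 (action_derivation G\<^sub>2 \<pi> X\<^sub>1))"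
    have sa: "ip\<^sub>2 (action_derivation G\<^sub>2 \<pi> X Y) Z = ip\<^sub>2 (action_derivation G\<^sub>2 \<pi> X Z) Y"
      if "X \<in> lie_algebra G\<^sub>1" "Y \<in> lie_algebra G\<^sub>2" "Z \<in> lie_algebra G\<^sub>2" for X Y Z
      using r that sym2[OF act[OF that(1,3)] that(2)] by (simp add: selfadjoint_on_def)
    have ?cyclic
    proof (intro ballI)
      fix X Y Z assume m: "X \<in> lie_algebra S" "Y \<in> lie_algebra S" "Z \<in> lie_algebra S"
      note X = split_prod(1,2)[OF m(1)] and Y = split_prod(1,2)[OF m(2)] and Z = split_prod(1,2)[OF m(3)]
      have c1: "ip\<^sub>1 (lie_bracket G\<^sub>1 (d\<^sub>1 X) (d\<^sub>1 Y)) (d\<^sub>1 Z) + ip\<^sub>1 (lie_bracket G\<^sub>1 (d\<^sub>1 Y) (d\<^sub>1 Z)) (d\<^sub>1 X) +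
          ip\<^sub>1 (lie_bracket G\<^sub>1 (d\<^sub>1 Z) (d\<^sub>1 X)) (d\<^sub>1 Y) = 0"
        using r X(1) Y(1) Z(1) unfolding M\<^sub>1.cyclic_left_invariant_metric_iff by blast
      have c2: "ip\<^sub>2 (lie_bracket G\<^sub>2 (d\<^sub>2 X) (d\<^sub>2 Y)) (d\<^sub>2 Z) + ip\<^sub>2 (lie_bracket G\<^sub>2 (d\<^sub>2 Y) (d\<^sub>2 Z)) (d\<^sub>2 X) +
          ip\<^sub>2 (lie_bracket G\<^sub>2 (d\<^sub>2 Z) (d\<^sub>2 X)) (d\<^sub>2 Y) = 0"
        using r X(2) Y(2) Z(2) unfolding M\<^sub>2.cyclic_left_invariant_metric_iff by blast
      show "product_inner G\<^sub>1 G\<^sub>2 ip\<^sub>1 ip\<^sub>2 (lie_bracket S X Y) Z + product_inner G\<^sub>1 G\<^sub>2 ip\<^sub>1 ip\<^sub>2 (lie_bracket S Y Z) X +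
          product_inner G\<^sub>1 G\<^sub>2 ip\<^sub>1 ip\<^sub>2 (lie_bracket S Z X) Y = 0"
        unfolding bracket[OF m] bracket[OF m(2,3,1)] bracket[OF m(3,1,2)]
        \<comment> \<open>By selfadjointness, the six action terms cancel in pairs, one pair for each of the three first
           components.\<close>
        using c1 c2 sa[OF X(1) Y(2) Z(2)] sa[OF Y(1) Z(2) X(2)] sa[OF Z(1) X(2) Y(2)] by linarith
    qed
    then show "defines_cyclic_metric S (product_inner G\<^sub>1 G\<^sub>2 ip\<^sub>1 ip\<^sub>2)" using lhs by blast
  qed
qed

end
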